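(* Let $0<\alpha\le1$ and $0<\lambda\le1$. Then, as $T\to\infty$, \[ \int_1^T\left|\zeta_L\!\left(\tfrac12+it,\alpha,\lambda\right)\right|^2dt =T\log\frac{T}{2\pi}+\begin{cases}O\big(T(\log T)^{1/2}\big) & (0<\alpha<1),\\ O\big(T(\log T)^{3/4}\big) & (\alpha=1).\end{cases} \]
   Context: For $0<\alpha\le1$, $0<\lambda\le1$ and $s=\sigma+it$ with $\sigma>1$, the Lerch zeta-function is $\zeta_L(s,\alpha,\lambda)=\sum_{n=0}^\infty e^{2\pi i n\lambda}(n+\alpha)^{-s}$, extended to the complex plane by analytic continuation. In particular $\zeta_L(s,\alpha,1)$ is the Hurwitz zeta-function $\sum_{n=0}^\infty (n+\alpha)^{-s}$. *)

theory Defs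
  imports "HOL-Complex_Analysis.Complex_Analysis" "HOL-Library.Landau_Symbols"
begin

definition lerch_series :: "real \<Rightarrow> real \<Rightarrow> complex \<Rightarrow> complex" where
  "lerch_series \<alpha> lam s =
     (\<Sum>n. exp (2 * of_real pi * \<i> * of_nat n * of_real lam) / (of_real (real n + \<alpha>)) powr s)"

text \<open>The Lerch zeta-function: the analytic continuation of the series to the
  connected open set C - {1} (for lambda < 1 it is entire; for lambda = 1 it has
  a simple pole at s = 1). By the identity theorem this continuation is unique.\<close>
definition lerch_zeta :: "complex \<Rightarrow> real \<Rightarrow> real \<Rightarrow> complex" where
  "lerch_zeta s \<alpha> lam =
     (SOME f. f holomorphic_on (UNIV - {1}) \<and>
        (\<forall>z. Re z > 1 \<longrightarrow> f z = lerch_series \<alpha> lam z)) s"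

end

theory Submission
  imports Defs
begin

text \<open>
  On \<open>Re s = 1/2\<close> write \<open>\<zeta>\<^sub>L = S - J + R\<close>, where \<open>S\<close> is the partial sum of length \<open>N \<sim> T\<close>, \<open>J\<close> is the
  boundary term of one integration or summation by parts, and \<open>R\<close> is an integral over
  \<open>w \<in> [0, 1]\<close> of \<open>s\<close> times a tail of the absolutely convergent series at \<open>s + 1\<close>.  Iterating the same identity
  continues \<open>\<zeta>\<^sub>L\<close> to the whole plane.  For a Dirichlet polynomial in \<open>n + \<beta>\<close> the off-diagonal terms
  of the mean square involve \<open>1 / ln (x / y)\<close>, which is \<open>sqrt (x y) / (x - y)\<close> up to a bounded error;
  Hilbert's inequality then bounds them by \<open>\<Sum> |b\<^sub>n|\<^sup>2 (n + \<beta>) + (\<Sum> |b\<^sub>n|)\<^sup>2\<close>.  This gives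
  \<open>T ln T + O(T)\<close> for \<open>S\<close> and \<open>O(T)\<close> for \<open>J\<close> and \<open>R\<close>, so the cross terms are
  \<open>O(T sqrt (ln T))\<close>.
\<close>

section \<open>Mean squares of Dirichlet polynomials\<close>

text \<open>The order \<open>T\<close> of the length \<open>N\<close> is forced from both sides by
  the bounds used. For \<open>S\<close> the weighted sum in the off-diagonal bound equals
  \<open>N\<close> exactly, so \<open>N\<close> must not exceed order \<open>T\<close>. For
  \<open>R\<close> the factor \<open>s\<close> costs \<open>T\<^sup>2\<close> in mean square, and
  the tail pays for it with \<open>O(1 / T)\<close> as soon as \<open>N \<ge> T\<close>. The
  integral over \<open>w\<close> is kept outside the tail. For fixed \<open>w\<close> the tail, cut
  at some finite \<open>M\<close>, is a Dirichlet polynomial in \<open>n + (\<alpha> + w)\<close>,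
  so one mean-square theorem serves both \<open>S\<close> and \<open>R\<close>; its bound for the
  tail depends neither on \<open>w\<close> nor on \<open>M\<close>, and \<open>M\<close> may
  therefore be chosen after \<open>T\<close>. \<open>lerch_zeta\<close> is obtained by choice from a
  defining property, so nothing is known about it until some continuation to the whole punctured
  plane has been exhibited. This is why the recursion is carried to every level, although level 1
  already reaches the critical line. The exponent 1/2 comes out for all \<open>\<alpha>\<close>
  alike; the bound with exponent 3/4 is a weakening of it.\<close>

lemma cmod_sum_square:
  fixes f :: "'a \<Rightarrow> complex"
  shows "of_real ((cmod (\<Sum>n\<in>S. f n))\<^sup>2) = (\<Sum>m\<in>S. \<Sum>n\<in>S. f m * cnj (f n))"
  by (simp only: complex_norm_square cnj_sum sum_product)

text \<open>These are the nonzero Fourier coefficients of the sawtooth; their decay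
  \<open>1 / k\<close> is the source of the Hilbert kernel. In \<open>F\<close> the terms over
  \<open>c\<^sup>2\<close> cancel because \<open>exp c = 1\<close>.\<close>

lemma has_integral_linear_cis:
  fixes k :: int
  assumes "k \<noteq> 0"
  shows "((\<lambda>x. of_real (x - 1/2) * cis (2 * pi * of_int k * x)) has_integral
           1 / (2 * pi * \<i> * of_int k)) {0..1}"
proof -
  define c :: complex where "c = 2 * pi * \<i> * of_int k"
  have c0: "c \<noteq> 0" using assms by (simp add: c_def)
  define F where "F = (\<lambda>z::complex. (z - 1/2) * exp (c * z) / c - exp (c * z) / c\<^sup>2)"
  have ec: "exp c = 1"
    using exp_integer_2pi[of "of_int k"] by (simp add: c_def mult_ac)
  have F': "(F has_field_derivative ((z - 1/2) * exp (c * z))) (at z within A)" for z A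
    unfolding F_def using c0
    by (auto intro!: derivative_eq_intros simp: field_simps power2_eq_square)
  have "((\<lambda>x. (of_real x - 1/2) * exp (c * of_real x)) has_integral
          (F (of_real 1) - F (of_real 0))) {0..1::real}"
    by (rule fundamental_theorem_of_calculus)
       (use has_vector_derivative_real_field[OF F'] in auto)
  moreover have "F (of_real 1) - F (of_real 0) = 1 / c"
    using c0 ec by (simp add: F_def field_simps power2_eq_square)
  moreover have "(of_real x - 1/2) * exp (c * of_real x)
      = of_real (x - 1/2) * cis (2 * pi * of_int k * x)" for x :: real
    by (simp add: c_def cis_conv_exp mult_ac)
  ultimately have "((\<lambda>x. of_real (x - 1/2) * cis (2 * pi * of_int k * x)) has_integral 1 / c) {0..1}"
    by (simp only:)
  then show ?thesis by (simp only: c_def)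
qed

lemma has_integral_cis:
  fixes d :: real
  assumes "d \<noteq> 0" "A \<le> B"
  shows "((\<lambda>t. cis (- (t * d))) has_integral
           (cis (- (A * d)) - cis (- (B * d))) / (\<i> * of_real d)) {A..B}"
proof -
  define c :: complex where "c = - \<i> * of_real d"
  have c0: "c \<noteq> 0" using assms by (simp add: c_def)
  have F': "((\<lambda>z. exp (c * z) / c) has_field_derivative exp (c * z)) (at z within X)" for z X
    using c0 by (auto intro!: derivative_eq_intros)
  have "((\<lambda>t. exp (c * of_real t)) has_integral
          (exp (c * of_real B) / c - exp (c * of_real A) / c)) {A..B}"
    by (rule fundamental_theorem_of_calculus)
       (use assms has_vector_derivative_real_field[OF F'] in auto)
  moreover have "exp (c * of_real t) = cis (- (t * d))" for t :: real
    by (simp add: c_def cis_conv_exp mult_ac)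
  moreover have "exp (c * of_real B) / c - exp (c * of_real A) / c
      = (exp (c * of_real A) - exp (c * of_real B)) / (\<i> * of_real d)"
    by (simp add: c_def divide_simps)
  ultimately show ?thesis by simp
qed

lemma sum_diagonal_split:
  assumes "finite S"
  shows "(\<Sum>m\<in>S. \<Sum>n\<in>S. f m n) = (\<Sum>m\<in>S. f m m) + (\<Sum>m\<in>S. \<Sum>n\<in>S-{m}. f m n :: 'a :: comm_monoid_add)"
  using assms by (simp add: sum.remove sum.distrib flip: sum.distrib)

text \<open>Multiplication by the bounded function \<open>x - 1/2\<close> has the Hilbert kernel as its matrix
  in the Fourier basis.\<close>
lemma hilbert_inequality:
  fixes d :: "nat \<Rightarrow> complex"
  assumes "finite S"
  shows "cmod (\<Sum>m\<in>S. \<Sum>n\<in>S-{m}. d m * cnj (d n) / of_real (real m - real n))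
           \<le> pi * (\<Sum>n\<in>S. (cmod (d n))\<^sup>2)"
proof -
  define P where "P = (\<lambda>x. \<Sum>n\<in>S. d n * cis (2 * pi * real n * x))"
  define H where "H = (\<Sum>m\<in>S. \<Sum>n\<in>S-{m}. d m * cnj (d n) / of_real (real m - real n))"
  define Q where "Q = (\<Sum>n\<in>S. (cmod (d n))\<^sup>2)"
  have P2: "of_real ((cmod (P x))\<^sup>2) =
      (\<Sum>m\<in>S. \<Sum>n\<in>S. d m * cnj (d n) * cis (2 * pi * of_int (int m - int n) * x))" for x
    unfolding P_def cmod_sum_square
    by (intro sum.cong refl) (simp add: cis_cnj cis_mult algebra_simps)
  have one: "((\<lambda>x. cis (2 * pi * of_int (int m - int n) * x)) has_integral
       (if m = n then 1 else 0)) {0..1}" for m n :: nat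
  proof (cases "m = n")
    case True
    then show ?thesis using has_integral_const_real[of "1::complex" 0 1] by simp
  next
    case False
    have "cis (2 * pi * of_int (int m - int n)) = 1"
      by (rule cis_multiple_2pi) auto
    with False show ?thesis
      using has_integral_cis[of "- (2 * pi * of_int (int m - int n))" 0 1]
      by (simp add: mult_ac)
  qed
  \<comment> \<open>The sawtooth has mean zero, so the diagonal coefficient vanishes and only the
    off-diagonal kernel survives.\<close>
  have two: "((\<lambda>x. of_real (x - 1/2) * cis (2 * pi * of_int (int m - int n) * x)) has_integral
       (if m = n then 0 else 1 / (2 * pi * \<i> * of_int (int m - int n)))) {0..1}" for m n :: nat
  proof (cases "m = n")
    case True
    have F': "((\<lambda>z::complex. z\<^sup>2/2 - z/2) has_field_derivative (z - 1/2)) (at z within A)" for z A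
      by (auto intro!: derivative_eq_intros)
    have "((\<lambda>x. of_real x - 1/2 :: complex) has_integral ((of_real 1)\<^sup>2/2 - of_real 1/2) - ((of_real 0)\<^sup>2/2 - of_real 0/2)) {0..1::real}"
      by (rule fundamental_theorem_of_calculus)
         (use has_vector_derivative_real_field[OF F'] in auto)
    with True show ?thesis by simp
  next
    case False
    then show ?thesis using has_integral_linear_cis[of "int m - int n"] by simp
  qed
  have "((\<lambda>x. of_real ((cmod (P x))\<^sup>2)) has_integral
      (\<Sum>m\<in>S. \<Sum>n\<in>S. d m * cnj (d n) * (if m = n then 1 else 0))) {0..1}"
    unfolding P2 by (intro has_integral_sum assms has_integral_mult_right one)
  also have "(\<Sum>m\<in>S. \<Sum>n\<in>S. d m * cnj (d n) * (if m = n then 1 else 0)) = of_real Q"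
    using assms by (simp add: Q_def complex_norm_square if_distrib[of "\<lambda>x. _ * x"] sum.delta' cong: if_cong del: of_real_power)
  finally have "((\<lambda>x. of_real ((cmod (P x))\<^sup>2)) has_integral complex_of_real Q) {0..1}" .
  from has_integral_Re[OF this] have int1: "((\<lambda>x. (cmod (P x))\<^sup>2) has_integral Q) {0..1}"
    by (simp del: of_real_power)
  have "((\<lambda>x. of_real ((x - 1/2) * (cmod (P x))\<^sup>2)) has_integral
      (\<Sum>m\<in>S. \<Sum>n\<in>S. d m * cnj (d n) * (if m = n then 0 else 1 / (2 * pi * \<i> * of_int (int m - int n))))) {0..1}"
    unfolding of_real_mult P2 sum_distrib_left
    apply (intro has_integral_sum assms)
    subgoal for m n
    proof -
      have "(\<lambda>x. of_real (x - 1/2) * (d m * cnj (d n) * cis (2 * pi * of_int (int m - int n) * x))) =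
          (\<lambda>x. d m * cnj (d n) * (of_real (x - 1/2) * cis (2 * pi * of_int (int m - int n) * x)))"
        by (simp only: mult_ac)
      then show ?thesis
        using has_integral_mult_right[OF two[of m n], of "d m * cnj (d n)"] by (simp only: of_real_mult)
    qed
    done
  also have "(\<Sum>m\<in>S. \<Sum>n\<in>S. d m * cnj (d n) * (if m = n then 0 else 1 / (2 * pi * \<i> * of_int (int m - int n)))) = H / (2 * pi * \<i>)"
    unfolding sum_diagonal_split[OF assms] H_def sum_divide_distrib
    by (simp, intro sum.cong refl, auto)
  finally have int2: "((\<lambda>x. of_real ((x - 1/2) * (cmod (P x))\<^sup>2)) has_integral H / (2 * pi * \<i>)) {0..1}" .
  \<comment> \<open>The sawtooth is at most 1/2 in modulus, so \<open>int2\<close> is at most half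
    of the Parseval integral \<open>int1\<close>. Clearing \<open>2 * pi\<close> produces the
    constant \<open>pi\<close>.\<close>
  have "norm (H / (2 * pi * \<i>)) \<le> Q / 2"
  proof -
    have "norm (integral {0..1} (\<lambda>x. of_real ((x - 1/2) * (cmod (P x))\<^sup>2) :: complex))
        \<le> integral {0..1} (\<lambda>x. (cmod (P x))\<^sup>2 / 2)"
    proof (rule integral_norm_bound_integral)
      show "(\<lambda>x. of_real ((x - 1/2) * (cmod (P x))\<^sup>2) :: complex) integrable_on {0..1}"
        using int2 by blast
      show "(\<lambda>x. (cmod (P x))\<^sup>2 / 2) integrable_on {0..1}"
        using has_integral_divide[OF int1] by blast
      fix x :: real assume "x \<in> {0..1}"
      then have "\<bar>x - 1/2\<bar> \<le> 1/2" by (auto simp: abs_if)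
      then have "\<bar>x - 1/2\<bar> * (cmod (P x))\<^sup>2 \<le> 1/2 * (cmod (P x))\<^sup>2"
        by (intro mult_right_mono) auto
      then show "norm (of_real ((x - 1/2) * (cmod (P x))\<^sup>2) :: complex) \<le> (cmod (P x))\<^sup>2 / 2"
        by (simp only: norm_of_real abs_mult) simp
    qed
    then show ?thesis
      using integral_unique[OF int2] integral_unique[OF has_integral_divide[OF int1, of 2]] by simp
  qed
  then show ?thesis
    unfolding H_def[symmetric] Q_def[symmetric] by (simp add: norm_divide norm_mult field_simps)
qed

text \<open>For \<open>y < x\<close> the inequality \<open>ln z \<le> z - 1\<close>, applied to
  \<open>x / y\<close> and to \<open>y / x\<close>, puts \<open>1 / ln (x / y)\<close> between
  \<open>y / (x - y)\<close> and \<open>x / (x - y)\<close>. The geometric mean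
  \<open>sqrt (x * y)\<close> puts the second quotient in the same interval, whose length is exactly
  1. The other order follows by antisymmetry.\<close>

lemma inverse_ln_approx:
  fixes x y :: real
  assumes "x > 0" "y > 0" "x \<noteq> y"
  shows "\<bar>1 / (ln x - ln y) - sqrt (x * y) / (x - y)\<bar> \<le> 1"
proof -
  have main: "\<bar>1 / (ln x - ln y) - sqrt (x * y) / (x - y)\<bar> \<le> 1" if "0 < y" "y < x" for x y :: real
  proof -
    define d where "d = ln x - ln y"
    have d0: "d > 0" using that by (simp add: d_def)
    have "d = ln (x / y)" "- d = ln (y / x)" using that by (auto simp: d_def ln_div)
    then have "d \<le> x / y - 1" "- d \<le> y / x - 1"
      using ln_le_minus_one[of "x / y"] ln_le_minus_one[of "y / x"] that by auto
    then have du: "d * y \<le> x - y" and dl: "x - y \<le> d * x"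
      using that by (auto simp: field_simps)
    have l: "y / (x - y) \<le> 1 / d" and u: "1 / d \<le> x / (x - y)"
      using du dl d0 that by (auto simp: field_simps)
    have "y \<le> sqrt (x * y)" "sqrt (x * y) \<le> x"
      using that by (auto intro!: real_le_rsqrt real_le_lsqrt simp: power2_eq_square)
    then have "y / (x - y) \<le> sqrt (x * y) / (x - y)" "sqrt (x * y) / (x - y) \<le> x / (x - y)"
      using that by (auto intro!: divide_right_mono)
    moreover have "x / (x - y) = y / (x - y) + 1" using that by (simp add: field_simps)
    ultimately show ?thesis using l u unfolding d_def by linarith
  qed
  show ?thesis
  proof (cases "y < x")
    case True then show ?thesis using main assms by auto
  next
    case False
    then have "\<bar>1 / (ln y - ln x) - sqrt (y * x) / (y - x)\<bar> \<le> 1" using main assms by auto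
    moreover have "1 / (ln x - ln y) - sqrt (x * y) / (x - y) = - (1 / (ln y - ln x) - sqrt (y * x) / (y - x))"
      using minus_divide_right[of 1 "ln y - ln x"] minus_divide_right[of "sqrt (x*y)" "y - x"]
      by (simp add: mult.commute)
    ultimately show ?thesis by (simp only: abs_minus_cancel)
  qed
qed

text \<open>The main term \<open>sqrt (x m * x n)\<close> of the kernel factors, so it is absorbed
  into the coefficients \<open>d\<close>; the shift \<open>\<beta>\<close> cancels in
  \<open>x m - x n\<close>, and the unweighted Hilbert inequality applies. The bounded remainder
  \<open>r\<close> is estimated trivially, which costs the square of the sum of the moduli.\<close>

lemma log_hilbert_inequality:
  fixes c :: "nat \<Rightarrow> complex"
  assumes S: "finite S" and pos: "\<And>n. n \<in> S \<Longrightarrow> real n + \<beta> > 0"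
  shows "cmod (\<Sum>m\<in>S. \<Sum>n\<in>S-{m}. c m * cnj (c n) / of_real (ln (real m + \<beta>) - ln (real n + \<beta>)))
           \<le> pi * (\<Sum>n\<in>S. (cmod (c n))\<^sup>2 * (real n + \<beta>)) + (\<Sum>n\<in>S. cmod (c n))\<^sup>2"
proof -
  define x where "x = (\<lambda>n. real n + \<beta>)"
  define d where "d = (\<lambda>n. c n * of_real (sqrt (x n)))"
  define r where "r = (\<lambda>m n. 1 / (ln (x m) - ln (x n)) - sqrt (x m * x n) / (x m - x n))"
  have r: "\<bar>r m n\<bar> \<le> 1" if "m \<in> S" "n \<in> S - {m}" for m n
    unfolding r_def using that pos by (intro inverse_ln_approx) (auto simp: x_def)
  have eq: "c m * cnj (c n) / of_real (ln (x m) - ln (x n)) =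
      d m * cnj (d n) / of_real (real m - real n) + c m * cnj (c n) * of_real (r m n)"
    if "m \<in> S" "n \<in> S - {m}" for m n
  proof -
    have "x m - x n = real m - real n" by (simp add: x_def)
    moreover have "1 / (ln (x m) - ln (x n)) = sqrt (x m) * sqrt (x n) / (x m - x n) + r m n"
      by (simp add: r_def real_sqrt_mult)
    ultimately have "complex_of_real (1 / (ln (x m) - ln (x n))) =
       of_real (sqrt (x m)) * of_real (sqrt (x n)) / of_real (real m - real n) + of_real (r m n)"
      by (metis of_real_add of_real_divide of_real_mult)
    then have "c m * cnj (c n) * complex_of_real (1 / (ln (x m) - ln (x n))) =
       c m * cnj (c n) * (of_real (sqrt (x m)) * of_real (sqrt (x n)) / of_real (real m - real n) + of_real (r m n))"
      by simp
    then show ?thesis by (simp add: d_def algebra_simps)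
  qed
  have "(\<Sum>m\<in>S. \<Sum>n\<in>S-{m}. c m * cnj (c n) / of_real (ln (x m) - ln (x n))) =
     (\<Sum>m\<in>S. \<Sum>n\<in>S-{m}. d m * cnj (d n) / of_real (real m - real n)) +
     (\<Sum>m\<in>S. \<Sum>n\<in>S-{m}. c m * cnj (c n) * of_real (r m n))" (is "_ = ?X + ?Y")
    unfolding sum.distrib[symmetric] by (intro sum.cong refl eq) auto
  also have "cmod \<dots> \<le> cmod ?X + cmod ?Y" by (rule norm_triangle_ineq)
  also have "cmod ?X \<le> pi * (\<Sum>n\<in>S. (cmod (d n))\<^sup>2)"
    by (rule hilbert_inequality[OF S])
  also have "(\<Sum>n\<in>S. (cmod (d n))\<^sup>2) = (\<Sum>n\<in>S. (cmod (c n))\<^sup>2 * x n)"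
    using pos by (intro sum.cong refl) (auto simp: d_def norm_mult power_mult_distrib x_def less_imp_le)
  also have "cmod ?Y \<le> (\<Sum>m\<in>S. \<Sum>n\<in>S-{m}. cmod (c m) * cmod (c n))"
  proof (intro order.trans[OF norm_sum] sum_mono)
    fix m n assume "m \<in> S" "n \<in> S - {m}"
    from mult_left_mono[OF r[OF this], of "cmod (c m) * cmod (c n)"]
    show "cmod (c m * cnj (c n) * of_real (r m n)) \<le> cmod (c m) * cmod (c n)"
      by (simp add: norm_mult)
  qed
  also have "\<dots> \<le> (\<Sum>m\<in>S. \<Sum>n\<in>S. cmod (c m) * cmod (c n))"
    by (intro sum_mono sum_mono2 S) auto
  also have "\<dots> = (\<Sum>n\<in>S. cmod (c n))\<^sup>2"
    by (simp add: power2_eq_square sum_product)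
  finally show ?thesis by (simp add: x_def)
qed

text \<open>Integrating an off-diagonal term leaves its phase at the two endpoints, divided by
  \<open>\<i> * (L m - L n)\<close>. The phase factors over \<open>m\<close> and \<open>n\<close>,
  so it can be moved into the coefficients \<open>c t n\<close>, whose moduli do not depend on
  \<open>t\<close>. Each endpoint is thus one logarithmic Hilbert form with the same bound, hence
  the factor 2 and an error free of \<open>B - A\<close>.\<close>

theorem dirichlet_polynomial_mean_square:
  fixes b :: "nat \<Rightarrow> complex"
  assumes S: "finite S" and pos: "\<And>n. n \<in> S \<Longrightarrow> real n + \<beta> > 0" and AB: "A \<le> B"
  shows "\<bar>integral {A..B} (\<lambda>t. (cmod (\<Sum>n\<in>S. b n * cis (- (t * ln (real n + \<beta>)))))\<^sup>2)
            - (B - A) * (\<Sum>n\<in>S. (cmod (b n))\<^sup>2)\<bar>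
          \<le> 2 * (pi * (\<Sum>n\<in>S. (cmod (b n))\<^sup>2 * (real n + \<beta>)) + (\<Sum>n\<in>S. cmod (b n))\<^sup>2)"
proof -
  define L where "L = (\<lambda>n. ln (real n + \<beta>))"
  define D where "D = (\<lambda>t. \<Sum>n\<in>S. b n * cis (- (t * L n)))"
  define c where "c = (\<lambda>t n. b n * cis (- (t * L n)))"
  define H where "H = (\<lambda>t. \<Sum>m\<in>S. \<Sum>n\<in>S-{m}. c t m * cnj (c t n) / of_real (L m - L n))"
  define R where "R = pi * (\<Sum>n\<in>S. (cmod (b n))\<^sup>2 * (real n + \<beta>)) + (\<Sum>n\<in>S. cmod (b n))\<^sup>2"
  have Hb: "cmod (H t) \<le> R" for t
    using log_hilbert_inequality[OF S pos, where c = "c t"]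
    by (simp add: H_def R_def L_def c_def norm_mult)
  have Linj: "L m \<noteq> L n" if "m \<in> S" "n \<in> S - {m}" for m n
    using that pos[of m] pos[of n] by (auto simp: L_def)
  have D2: "of_real ((cmod (D t))\<^sup>2) = (\<Sum>m\<in>S. \<Sum>n\<in>S. b m * cnj (b n) * cis (- (t * (L m - L n))))" for t
    unfolding D_def cmod_sum_square
    by (intro sum.cong refl) (simp add: cis_cnj cis_mult algebra_simps)
  define I where "I = (\<lambda>m n. if m = n then of_real (B - A)
      else (cis (- (A * (L m - L n))) - cis (- (B * (L m - L n)))) / (\<i> * of_real (L m - L n)))"
  have "((\<lambda>t. of_real ((cmod (D t))\<^sup>2)) has_integral
      (\<Sum>m\<in>S. \<Sum>n\<in>S. b m * cnj (b n) * I m n)) {A..B}"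
    unfolding D2
  proof (intro has_integral_sum S has_integral_mult_right)
    fix m n assume mn: "m \<in> S" "n \<in> S"
    show "((\<lambda>t. cis (- (t * (L m - L n)))) has_integral I m n) {A..B}"
    proof (cases "m = n")
      case True
      then show ?thesis
        using has_integral_const_real[of "1::complex" A B] AB by (simp add: I_def scaleR_conv_of_real)
    next
      case False
      then show ?thesis using has_integral_cis[of "L m - L n" A B] AB Linj[of m n] mn by (simp add: I_def)
    qed
  qed
  also have "(\<Sum>m\<in>S. \<Sum>n\<in>S. b m * cnj (b n) * I m n) =
      of_real ((B - A) * (\<Sum>n\<in>S. (cmod (b n))\<^sup>2)) + (H A - H B) / \<i>"
  proof -
    have "(\<Sum>m\<in>S. b m * cnj (b m) * I m m) = of_real ((B - A) * (\<Sum>n\<in>S. (cmod (b n))\<^sup>2))"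
      by (simp add: I_def complex_norm_square sum_distrib_left mult_ac del: of_real_diff of_real_power)
    moreover have "(\<Sum>m\<in>S. \<Sum>n\<in>S-{m}. b m * cnj (b n) * I m n) = (H A - H B) / \<i>"
      unfolding H_def sum_subtractf[symmetric] sum_divide_distrib
    proof (intro sum.cong refl)
      fix m n assume mn: "m \<in> S" "n \<in> S - {m}"
      have "c t m * cnj (c t n) = b m * cnj (b n) * cis (- (t * (L m - L n)))" for t
        by (simp add: c_def cis_cnj cis_mult algebra_simps)
      moreover have "x * ((p - q) / (\<i> * l)) = (x * p / l - x * q / l) / \<i>" for x p q l :: complex
        by (cases "l = 0") (simp_all add: field_simps)
      moreover have "I m n = (cis (- (A * (L m - L n))) - cis (- (B * (L m - L n)))) / (\<i> * of_real (L m - L n))"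
        using mn by (simp add: I_def)
      ultimately show "b m * cnj (b n) * I m n = (c A m * cnj (c A n) / of_real (L m - L n)
           - c B m * cnj (c B n) / of_real (L m - L n)) / \<i>"
        by (simp only:)
    qed
    ultimately show ?thesis by (simp only: sum_diagonal_split[OF S])
  qed
  finally have hi: "((\<lambda>t. of_real ((cmod (D t))\<^sup>2)) has_integral
      of_real ((B - A) * (\<Sum>n\<in>S. (cmod (b n))\<^sup>2)) + (H A - H B) / \<i>) {A..B}" .
  have "((\<lambda>t. (cmod (D t))\<^sup>2) has_integral
      Re (of_real ((B - A) * (\<Sum>n\<in>S. (cmod (b n))\<^sup>2)) + (H A - H B) / \<i>)) {A..B}"
    using has_integral_Re[OF hi] by (simp del: of_real_power)
  then have "integral {A..B} (\<lambda>t. (cmod (D t))\<^sup>2) - (B - A) * (\<Sum>n\<in>S. (cmod (b n))\<^sup>2) = Re ((H A - H B) / \<i>)"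
    by (simp add: integral_unique)
  moreover have "\<bar>Re ((H A - H B) / \<i>)\<bar> \<le> cmod ((H A - H B) / \<i>)" by (rule abs_Re_le_cmod)
  moreover have "cmod ((H A - H B) / \<i>) \<le> cmod (H A) + cmod (H B)"
    unfolding norm_divide using norm_triangle_ineq4[of "H A" "H B"] by simp
  ultimately show ?thesis using Hb[of A] Hb[of B] by (simp add: D_def L_def R_def)
qed

section \<open>Partial sums and their boundary terms\<close>

definition twist :: "real \<Rightarrow> nat \<Rightarrow> complex" where
  "twist lam n = cis (2 * pi * real n * lam)"

text \<open>The weight left on the derivative of \<open>(x + w) powr (- s)\<close> after the
  summation or integration by parts. For \<open>lam = 1\<close> it vanishes at \<open>w = 1\<close>,
  so only the sample at \<open>x\<close> remains; for \<open>lam < 1\<close> it is the constant from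
  summing the geometric sequence \<open>twist\<close>.\<close>

definition lerch_kernel :: "real \<Rightarrow> real \<Rightarrow> complex" where
  "lerch_kernel lam w = (if lam = 1 then of_real (1 - w) else 1 / (1 - cis (- 2 * pi * lam)))"

text \<open>An antiderivative in both cases. For \<open>lam = 1\<close> it is that of
  \<open>x powr (- s)\<close>; otherwise the factor in front of the power is a sequence in
  \<open>n\<close> whose forward difference is \<open>twist lam n\<close>.\<close>

definition lerch_boundary :: "real \<Rightarrow> complex \<Rightarrow> nat \<Rightarrow> real \<Rightarrow> complex" where
  "lerch_boundary lam s n x = (if lam = 1 then of_real x powr (1 - s) / (1 - s)
     else twist lam n * cis (- 2 * pi * lam) / (1 - cis (- 2 * pi * lam)) * of_real x powr (- s))"

lemma norm_twist [simp]: "norm (twist lam n) = 1"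
  by (simp add: twist_def)

lemma twist_0 [simp]: "twist lam 0 = 1"
  by (simp add: twist_def)

lemma twist_1 [simp]: "twist 1 n = 1"
  using cis_multiple_2pi[of "real n"] by (simp add: twist_def)

lemma twist_Suc: "twist lam (Suc n) * cis (- 2 * pi * lam) = twist lam n"
  by (simp add: twist_def cis_mult algebra_simps)

lemma cis_lam_ne_1:
  assumes "0 < lam" "lam < 1"
  shows "cis (- 2 * pi * lam) \<noteq> 1"
proof
  assume "cis (- 2 * pi * lam) = 1"
  then have "exp (\<i> * of_real (- 2 * pi * lam)) = 1" by (simp add: cis_conv_exp)
  then obtain n :: int where "- 2 * pi * lam = of_int (2 * n) * pi"
    unfolding exp_eq_1 by auto
  then have "pi * (lam + of_int n) = 0" by (simp add: algebra_simps)
  then have "lam = of_int (- n)" by simp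
  with assms show False by simp
qed

lemma norm_of_real_powr:
  "x > 0 \<Longrightarrow> norm (of_real x powr s :: complex) = x powr Re s"
  by (simp add: norm_powr_real_powr)

lemma has_vector_derivative_shift_powr:
  assumes "x + w > 0"
  shows "((\<lambda>w. of_real (x + w) powr s :: complex) has_vector_derivative
           s * of_real (x + w) powr (s - 1)) (at w within A)"
proof -
  have "of_real x + of_real w \<notin> (\<real>\<^sub>\<le>\<^sub>0 :: complex set)"
    using assms by (metis of_real_add nonpos_Reals_of_real_iff not_le)
  then have "((\<lambda>z. (of_real x + z) powr s :: complex) has_field_derivative
      s * (of_real x + of_real w) powr (s - 1)) (at (of_real w))"
    by (auto intro!: derivative_eq_intros)
  from has_vector_derivative_real_field[OF this] show ?thesis by simp
qed

lemma continuous_on_shift_powr: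
  fixes g :: "'a :: topological_space \<Rightarrow> complex" and f :: "'a \<Rightarrow> real"
  assumes "continuous_on A f" "continuous_on A g" "\<And>x. x \<in> A \<Longrightarrow> f x > 0"
  shows "continuous_on A (\<lambda>x. of_real (f x) powr g x)"
  using assms by (intro continuous_intros) (auto simp: less_imp_le dest: assms(3))

lemma continuous_on_lerch_kernel: "continuous_on A (lerch_kernel lam)"
  by (cases "lam = 1") (simp_all add: lerch_kernel_def [abs_def] continuous_intros)

lemma lerch_kernel_bounded: "\<exists>K\<ge>0. \<forall>w\<in>{0..1}. norm (lerch_kernel lam w) \<le> K"
proof (cases "lam = 1")
  case True
  then show ?thesis by (intro exI[of _ 1]) (auto simp: lerch_kernel_def simp flip: of_real_diff)
next
  case False
  then show ?thesis
    by (intro exI[of _ "norm (1 / (1 - cis (- 2 * pi * lam)))"]) (auto simp: lerch_kernel_def)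
qed

text \<open>Integration by parts over \<open>[x, x + 1]\<close> for \<open>lam = 1\<close>, summation by parts otherwise.\<close>
lemma lerch_step:
  assumes lam: "0 < lam" "lam \<le> 1" and x: "x > 0" and s: "s \<noteq> 1"
  shows "((\<lambda>w. s * (lerch_kernel lam w * (twist lam n * of_real (x + w) powr (- s - 1)))) has_integral
      twist lam n * of_real x powr (- s) -
      (lerch_boundary lam s (Suc n) (x + 1) - lerch_boundary lam s n x)) {0..1}"
proof (cases "lam = 1")
  case True
  define F where "F = (\<lambda>w. - (of_real (1 - w) * of_real (x + w) powr (- s)) - of_real (x + w) powr (1 - s) / (1 - s) :: complex)"
  have "((\<lambda>w. s * (of_real (1 - w) * of_real (x + w) powr (- s - 1))) has_integral (F 1 - F 0)) {0..1}"
  proof (rule fundamental_theorem_of_calculus)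
    fix w :: real assume "w \<in> {0..1}"
    then have xw: "x + w > 0" using x by simp
    have "((\<lambda>w. of_real (1 - w) :: complex) has_vector_derivative - 1) (at w within {0..1})"
      by (auto intro!: derivative_eq_intros)
    note has_vector_derivative_mult[OF this has_vector_derivative_shift_powr[OF xw, of "- s"]]
    from has_vector_derivative_diff[OF has_vector_derivative_minus[OF this]
      has_vector_derivative_divide[OF has_vector_derivative_shift_powr[OF xw, of "1 - s"], of "1 - s"]]
    show "(F has_vector_derivative s * (of_real (1 - w) * of_real (x + w) powr (- s - 1))) (at w within {0..1})"
      using s by (simp add: F_def mult_ac)
  qed simp
  with True show ?thesis
    by (simp add: F_def lerch_kernel_def lerch_boundary_def algebra_simps)
next
  case False
  define e where "e = cis (- 2 * pi * lam)"
  have e: "1 - e \<noteq> 0" using cis_lam_ne_1 lam False by (auto simp: e_def)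
  have "((\<lambda>w. - s * of_real (x + w) powr (- s - 1)) has_integral
     (of_real (x + 1) powr (- s) - of_real (x + 0) powr (- s))) {0..1}"
  proof (rule fundamental_theorem_of_calculus)
    fix w :: real assume "w \<in> {0..1}"
    then show "((\<lambda>w. of_real (x + w) powr (- s)) has_vector_derivative
        - s * of_real (x + w) powr (- s - 1)) (at w within {0..1})"
      using x by (intro has_vector_derivative_shift_powr) auto
  qed simp
  from has_integral_mult_right[OF this, of "- (twist lam n / (1 - e))"]
  have "((\<lambda>w. s * (lerch_kernel lam w * (twist lam n * of_real (x + w) powr (- s - 1)))) has_integral
     (- (twist lam n / (1 - e)) * (of_real (x + 1) powr (- s) - of_real x powr (- s)))) {0..1}"
    using False by (simp add: lerch_kernel_def e_def mult_ac)
  also have "- (twist lam n / (1 - e)) * (of_real (x + 1) powr (- s) - of_real x powr (- s)) =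
     twist lam n * of_real x powr (- s) -
      (twist lam n / (1 - e) * of_real (x + 1) powr (- s) - twist lam n * e / (1 - e) * of_real x powr (- s))"
  proof -
    have "- (t / (1 - e)) * (p - q) = t * q - (t / (1 - e) * p - t * e / (1 - e) * q)" for t p q :: complex
      using e by (simp add: divide_simps) (simp add: algebra_simps)
    then show ?thesis .
  qed
  finally show ?thesis
    using False twist_Suc[of lam n] by (simp add: lerch_boundary_def e_def)
qed

text \<open>The boundary terms telescope, and the sum under the integral is of the same kind, at
  \<open>s + 1\<close> with parameter \<open>u + w\<close>. This closure is why \<open>u\<close>
  ranges over all positive reals: it allows iteration and leaves a Dirichlet polynomial for each
  \<open>w\<close>.\<close>

lemma lerch_partial_sum:
  assumes lam: "0 < lam" "lam \<le> 1" and u: "u > 0" and s: "s \<noteq> 1" and NM: "N \<le> M"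
  shows "((\<lambda>w. s * (lerch_kernel lam w * (\<Sum>n\<in>{N..<M}. twist lam n * of_real (real n + (u + w)) powr (- s - 1)))) has_integral
      (\<Sum>n\<in>{N..<M}. twist lam n * of_real (real n + u) powr (- s)) -
      (lerch_boundary lam s M (real M + u) - lerch_boundary lam s N (real N + u))) {0..1}"
proof -
  have "((\<lambda>w. \<Sum>n\<in>{N..<M}. s * (lerch_kernel lam w * (twist lam n * of_real ((real n + u) + w) powr (- s - 1)))) has_integral
    (\<Sum>n\<in>{N..<M}. twist lam n * of_real (real n + u) powr (- s) -
      (lerch_boundary lam s (Suc n) (real n + u + 1) - lerch_boundary lam s n (real n + u)))) {0..1}"
    by (intro has_integral_sum lerch_step lam s finite_atLeastLessThan) (use u in auto)
  moreover have "(\<Sum>n\<in>{N..<M}. lerch_boundary lam s (Suc n) (real n + u + 1) - lerch_boundary lam s n (real n + u))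
      = lerch_boundary lam s M (real M + u) - lerch_boundary lam s N (real N + u)"
    using sum_Suc_diff'[OF NM, of "\<lambda>n. lerch_boundary lam s n (real n + u)"] by (simp add: add_ac)
  ultimately show ?thesis
    by (simp add: sum_subtractf sum_distrib_left add.assoc)
qed

section \<open>The series in its half-plane of absolute convergence, as a function of both
  variables\<close>

definition lerch_sum :: "real \<Rightarrow> complex \<Rightarrow> real \<Rightarrow> complex" where
  "lerch_sum lam s u = (\<Sum>n. twist lam n * of_real (real n + u) powr (- s))"

lemma lerch_series_eq: "\<alpha> > 0 \<Longrightarrow> lerch_series \<alpha> lam s = lerch_sum lam s \<alpha>"
  unfolding lerch_series_def lerch_sum_def
  by (simp add: twist_def cis_conv_exp powr_minus divide_inverse mult_ac)

text \<open>The majorant \<open>n powr (- \<delta>)\<close> does not depend on \<open>u\<close>, and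
  the term at \<open>n = 0\<close>, the only one that is large for small \<open>u\<close>, does not
  affect uniformity. Uniformity in \<open>s\<close> and \<open>u\<close> together gives joint
  continuity and, later, passage to the limit under the integral over \<open>w\<close>.\<close>

lemma lerch_sum_uniform_limit:
  assumes "\<delta> > 1"
  shows "uniform_limit {(s, u). Re s \<ge> \<delta> \<and> u > 0}
    (\<lambda>N (s, u). \<Sum>n<N. twist lam n * of_real (real n + u) powr (- s))
    (\<lambda>(s, u). lerch_sum lam s u) sequentially"
proof -
  have "uniform_limit {(s, u). Re s \<ge> \<delta> \<and> u > 0}
    (\<lambda>N x. \<Sum>n<N. twist lam n * of_real (real n + snd x) powr (- fst x))
    (\<lambda>x. \<Sum>n. twist lam n * of_real (real n + snd x) powr (- fst x)) sequentially"
  proof (rule Weierstrass_m_test_ev)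
    show "summable (\<lambda>n. real n powr (- \<delta>))"
      using assms by (simp add: summable_real_powr_iff)
    show "\<forall>\<^sub>F n in sequentially. \<forall>x\<in>{(s, u). Re s \<ge> \<delta> \<and> u > 0}.
        norm (twist lam n * of_real (real n + snd x) powr (- fst x)) \<le> real n powr (- \<delta>)"
      using eventually_ge_at_top[of 1]
    proof eventually_elim
      case (elim n)
      show ?case
      proof safe
        fix s :: complex and u :: real assume *: "Re s \<ge> \<delta>" "u > 0"
        have "(real n + u) powr (- Re s) \<le> (real n + u) powr (- \<delta>)"
          using * elim by (intro powr_mono) auto
        also have "\<dots> \<le> real n powr (- \<delta>)"
          using * elim assms by (intro powr_mono2') auto
        finally show "norm (twist lam n * of_real (real n + snd (s, u)) powr (- fst (s, u))) \<le> real n powr (- \<delta>)"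
          using * by (simp add: norm_mult norm_of_real_powr del: of_real_add)
      qed
    qed
  qed
  then show ?thesis by (simp add: case_prod_unfold lerch_sum_def)
qed

lemma continuous_on_lerch_sum:
  "continuous_on ({s. Re s > 1} \<times> {0<..}) (\<lambda>(s, u). lerch_sum lam s u)"
proof -
  have op: "open {p :: complex \<times> real. \<delta> < Re (fst p) \<and> 0 < snd p}" for \<delta>
    by (intro open_Collect_conj open_Collect_less continuous_intros)
  have *: "continuous_on {p :: complex \<times> real. \<delta> < Re (fst p) \<and> 0 < snd p} (\<lambda>(s, u). lerch_sum lam s u)"
    if \<delta>: "\<delta> > 1" for \<delta>
  proof (rule uniform_limit_theorem)
    show "uniform_limit {p :: complex \<times> real. \<delta> < Re (fst p) \<and> 0 < snd p}
       (\<lambda>N (s, u). \<Sum>n<N. twist lam n * of_real (real n + u) powr (- s))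
       (\<lambda>(s, u). lerch_sum lam s u) sequentially"
      by (rule uniform_limit_on_subset[OF lerch_sum_uniform_limit[OF \<delta>]]) auto
    show "\<forall>\<^sub>F N in sequentially. continuous_on {p :: complex \<times> real. \<delta> < Re (fst p) \<and> 0 < snd p}
       (\<lambda>(s, u). \<Sum>n<N. twist lam n * of_real (real n + u) powr (- s))"
      unfolding case_prod_unfold
      by (intro always_eventually allI continuous_on_sum continuous_on_mult continuous_on_const
           continuous_on_shift_powr continuous_intros) auto
  qed auto
  have "isCont (\<lambda>(s, u). lerch_sum lam s u) p" if p: "p \<in> {s. Re s > 1} \<times> {0<..}" for p
  proof -
    define \<delta> where "\<delta> = (1 + Re (fst p)) / 2"
    have "\<delta> > 1" "p \<in> {p. \<delta> < Re (fst p) \<and> 0 < snd p}"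
      using p by (auto simp: \<delta>_def)
    then show ?thesis using * op continuous_on_eq_continuous_at by blast
  qed
  then show ?thesis by (intro continuous_at_imp_continuous_on) auto
qed

lemma holomorphic_on_lerch_sum:
  assumes u: "u > 0"
  shows "(\<lambda>s. lerch_sum lam s u) holomorphic_on {s. Re s > 1}"
proof (rule holomorphic_uniform_sequence)
  show "open {s. 1 < Re s}" by (simp add: open_halfspace_Re_gt)
  show "(\<lambda>s. \<Sum>n<N. twist lam n * of_real (real n + u) powr (- s)) holomorphic_on {s. 1 < Re s}" for N
    by (intro holomorphic_intros)
  fix x assume x: "x \<in> {s. 1 < Re s}"
  define d where "d = (Re x - 1) / 2"
  have sub: "Re y \<ge> (1 + Re x) / 2" if "y \<in> cball x d" for y
    using that abs_Re_le_cmod[of "x - y"] by (auto simp: d_def dist_norm field_simps)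
  have "uniform_limit (cball x d) (\<lambda>N s. \<Sum>n<N. twist lam n * of_real (real n + u) powr (- s))
     (\<lambda>s. lerch_sum lam s u) sequentially"
  proof (rule uniform_limitI)
    fix e :: real assume "e > 0"
    from uniform_limitD[OF lerch_sum_uniform_limit[of "(1 + Re x) / 2" lam] this] x
    have "\<forall>\<^sub>F n in sequentially. \<forall>p\<in>{(s, v). (1 + Re x) / 2 \<le> Re s \<and> 0 < v}.
        dist (case p of (s, v) \<Rightarrow> \<Sum>n<n. twist lam n * of_real (real n + v) powr (- s)) (case p of (s, v) \<Rightarrow> lerch_sum lam s v) < e"
      by auto
    then show "\<forall>\<^sub>F n in sequentially. \<forall>s\<in>cball x d.
        dist (\<Sum>n<n. twist lam n * of_real (real n + u) powr (- s)) (lerch_sum lam s u) < e"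
      by eventually_elim (use sub u in force)
  qed
  moreover have "cball x d \<subseteq> {s. 1 < Re s}"
    using sub x by force
  ultimately show "\<exists>d>0. cball x d \<subseteq> {s. 1 < Re s} \<and> uniform_limit (cball x d)
     (\<lambda>N s. \<Sum>n<N. twist lam n * of_real (real n + u) powr (- s)) (\<lambda>s. lerch_sum lam s u) sequentially"
    using x by (intro exI[of _ d]) (auto simp: d_def)
qed

section \<open>Analytic continuation\<close>

text \<open>Morera's theorem: on each side of a triangle the contour integral is exchanged with the
  integral over \<open>w\<close>, and Cauchy's theorem makes the inner sum over the three sides
  vanish for every \<open>w\<close>.\<close>

lemma holomorphic_on_param_integral:
  fixes G :: "complex \<Rightarrow> real \<Rightarrow> complex"
  assumes S: "open S"
    and cont: "continuous_on (S \<times> {0..1}) (\<lambda>(s, w). G s w)"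
    and hol: "\<And>w. w \<in> {0..1} \<Longrightarrow> (\<lambda>s. G s w) holomorphic_on S"
  shows "(\<lambda>s. integral {0..1} (G s)) holomorphic_on S"
proof -
  define f where "f = (\<lambda>s. integral {0..1} (G s))"
  have contf: "continuous_on S f"
    unfolding f_def using integral_continuous_on_param[of S 0 1 G] cont by simp
  have cont2: "continuous_on ({0..1} \<times> {0..1}) (\<lambda>(x, w). G (linepath a b x) w * (b - a))"
    if "closed_segment a b \<subseteq> S" for a b
  proof -
    have "continuous_on ({0..1} \<times> {0..1}) (\<lambda>p. (\<lambda>(s, w). G s w) (linepath a b (fst p), snd p))"
      by (rule continuous_on_compose2[OF cont])
         (use that linepath_in_path[of _ a b] in \<open>auto simp: linepath_def intro!: continuous_intros\<close>)
    then show ?thesis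
      by (auto simp: case_prod_unfold intro!: continuous_intros)
  qed
  have swap: "contour_integral (linepath a b) f = integral {0..1} (\<lambda>w. contour_integral (linepath a b) (\<lambda>s. G s w))"
    and int: "(\<lambda>w. contour_integral (linepath a b) (\<lambda>s. G s w)) integrable_on {0..1}"
    if seg: "closed_segment a b \<subseteq> S" for a b
  proof -
    have "continuous_on (cbox (0, 0) (1, 1)) (\<lambda>(x, w). G (linepath a b x) w * (b - a))"
      using cont2[OF seg] by (simp add: cbox_Pair_eq)
    from integral_swap_continuous[OF this]
    have "integral {0..1} (\<lambda>x. integral {0..1} (\<lambda>w. G (linepath a b x) w * (b - a))) =
      integral {0..1} (\<lambda>w. integral {0..1} (\<lambda>x. G (linepath a b x) w * (b - a)))" by simp
    then show "contour_integral (linepath a b) f = integral {0..1} (\<lambda>w. contour_integral (linepath a b) (\<lambda>s. G s w))"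
      by (simp add: contour_integral_integral f_def)
    have "continuous_on ({0..1} \<times> {0..1}) (\<lambda>p. (\<lambda>(x, w). G (linepath a b x) w * (b - a)) (snd p, fst p))"
      by (rule continuous_on_compose2[OF cont2[OF seg]]) (auto intro!: continuous_intros)
    then have "continuous_on ({0..1} \<times> {0..1}) (\<lambda>(w, x). G (linepath a b x) w * (b - a))"
      by (simp add: case_prod_unfold)
    then have "continuous_on {0..1} (\<lambda>w. integral {0..1} (\<lambda>x. G (linepath a b x) w * (b - a)))"
      using integral_continuous_on_param[of "{0..1}" 0 1 "\<lambda>w x. G (linepath a b x) w * (b - a)"] by simp
    then show "(\<lambda>w. contour_integral (linepath a b) (\<lambda>s. G s w)) integrable_on {0..1}"
      by (intro integrable_continuous_interval) (simp add: contour_integral_integral)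
  qed
  have "f analytic_on S"
  proof (rule Morera_triangle[OF contf S], rule impI)
    fix a b c assume abc: "convex hull {a, b, c} \<subseteq> S"
    have segs: "closed_segment a b \<subseteq> S" "closed_segment b c \<subseteq> S" "closed_segment c a \<subseteq> S"
      using abc segments_subset_convex_hull order.trans by metis+
    have "contour_integral (linepath a b) f + contour_integral (linepath b c) f + contour_integral (linepath c a) f =
      integral {0..1} (\<lambda>w. contour_integral (linepath a b) (\<lambda>s. G s w) +
        contour_integral (linepath b c) (\<lambda>s. G s w) + contour_integral (linepath c a) (\<lambda>s. G s w))"
      using int segs by (simp add: swap integral_add integrable_add)
    also have "\<dots> = integral {0..1} (\<lambda>w::real. 0)"
    proof (rule integral_cong)
      fix w :: real assume "w \<in> {0..1}"
      then have "(\<lambda>s. G s w) holomorphic_on convex hull {a, b, c}"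
        using hol abc holomorphic_on_subset by blast
      then show "contour_integral (linepath a b) (\<lambda>s. G s w) +
        contour_integral (linepath b c) (\<lambda>s. G s w) + contour_integral (linepath c a) (\<lambda>s. G s w) = 0"
        by (intro has_chain_integral_chain_integral3 Cauchy_theorem_triangle)
    qed
    finally show "contour_integral (linepath a b) f + contour_integral (linepath b c) f + contour_integral (linepath c a) f = 0"
      by simp
  qed
  then show ?thesis
    by (simp add: f_def analytic_imp_holomorphic)
qed

text \<open>The first term of the recursion: \<open>(1 - s)\<close> times the boundary term at \<open>n = 0\<close>, with the
  removable singularity at \<open>s = 1\<close> filled in.\<close>
definition lerch_main :: "real \<Rightarrow> complex \<Rightarrow> real \<Rightarrow> complex" where
  "lerch_main lam s u = (if lam = 1 then of_real u powr (1 - s)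
     else (1 - s) * (cis (- 2 * pi * lam) / (1 - cis (- 2 * pi * lam)) * of_real u powr (- s)))"

lemma lerch_main_eq: "s \<noteq> 1 \<Longrightarrow> lerch_main lam s u = (1 - s) * lerch_boundary lam s 0 u"
  by (simp add: lerch_main_def lerch_boundary_def)

text \<open>\<open>lerch_cont lam k s u\<close> continues \<open>(s - 1) * lerch_sum lam s u\<close> to \<open>Re s > 1 - k\<close>.\<close>
fun lerch_cont :: "real \<Rightarrow> nat \<Rightarrow> complex \<Rightarrow> real \<Rightarrow> complex" where
  "lerch_cont lam 0 s u = (s - 1) * lerch_sum lam s u"
| "lerch_cont lam (Suc k) s u = lerch_main lam s u +
     (s - 1) * integral {0..1} (\<lambda>w. lerch_kernel lam w * lerch_cont lam k (s + 1) (u + w))"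

section \<open>Regularity of the recursion and agreement of its levels\<close>

lemma continuous_on_lerch_main: "continuous_on (UNIV \<times> {0<..}) (\<lambda>(s, u). lerch_main lam s u)"
proof (cases "lam = 1")
  case True
  then show ?thesis
    unfolding lerch_main_def case_prod_unfold if_P[OF True]
    by (intro continuous_on_shift_powr continuous_intros) auto
next
  case False
  then show ?thesis
    unfolding lerch_main_def case_prod_unfold if_not_P[OF False]
    by (intro continuous_on_const continuous_on_mult continuous_on_diff continuous_on_shift_powr
          continuous_on_minus continuous_on_fst continuous_on_snd continuous_on_id) auto
qed

lemma holomorphic_on_lerch_main: "(\<lambda>s. lerch_main lam s u) holomorphic_on A"
  unfolding lerch_main_def by (cases "lam = 1") (auto intro!: holomorphic_intros)

text \<open>Joint continuity is what the induction needs, since the next level integrates the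
  present one along \<open>(s + 1, u + w)\<close>.\<close>

lemma continuous_on_lerch_cont:
  "continuous_on ({s. Re s > 1 - real k} \<times> {0<..}) (\<lambda>(s, u). lerch_cont lam k s u)"
proof (induction k)
  case 0
  show ?case
    using continuous_on_lerch_sum[of lam]
    by (auto simp: case_prod_unfold intro!: continuous_intros)
next
  case (Suc k)
  let ?U = "{s. Re s > 1 - real (Suc k)} \<times> {0::real<..}"
  have "continuous_on (?U \<times> {0..1}) (\<lambda>p. (\<lambda>(s, u). lerch_cont lam k s u) (fst (fst p) + 1, snd (fst p) + snd p))"
    by (rule continuous_on_compose2[OF Suc.IH]) (auto intro!: continuous_intros)
  moreover have "continuous_on (?U \<times> {0..1}) (\<lambda>p. lerch_kernel lam (snd p))"
    by (rule continuous_on_compose2[OF continuous_on_lerch_kernel[of UNIV]]) (auto intro!: continuous_intros)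
  ultimately have "continuous_on (?U \<times> {0..1})
     (\<lambda>(p, w). lerch_kernel lam w * lerch_cont lam k (fst p + 1) (snd p + w))"
    by (auto simp: case_prod_unfold intro!: continuous_intros)
  then have "continuous_on ?U (\<lambda>p. integral {0..1} (\<lambda>w. lerch_kernel lam w * lerch_cont lam k (fst p + 1) (snd p + w)))"
    using integral_continuous_on_param[of ?U 0 1 "\<lambda>p w. lerch_kernel lam w * lerch_cont lam k (fst p + 1) (snd p + w)"]
    by simp
  moreover have "continuous_on ?U (\<lambda>(s, u). lerch_main lam s u)"
    by (rule continuous_on_subset[OF continuous_on_lerch_main]) auto
  ultimately show ?case
    by (auto simp: case_prod_unfold intro!: continuous_intros)
qed

lemma holomorphic_on_lerch_cont:
  "u > 0 \<Longrightarrow> (\<lambda>s. lerch_cont lam k s u) holomorphic_on {s. Re s > 1 - real k}"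
proof (induction k arbitrary: u)
  case 0
  then show ?case
    using holomorphic_on_lerch_sum[of u lam] by (auto intro!: holomorphic_intros)
next
  case (Suc k)
  let ?S = "{s. Re s > 1 - real (Suc k)}"
  have "(\<lambda>s. integral {0..1} (\<lambda>w. lerch_kernel lam w * lerch_cont lam k (s + 1) (u + w))) holomorphic_on ?S"
  proof (rule holomorphic_on_param_integral)
    show "open ?S" by (simp add: open_halfspace_Re_gt)
    have "continuous_on (?S \<times> {0..1}) (\<lambda>p. (\<lambda>(s, u). lerch_cont lam k s u) (fst p + 1, u + snd p))"
      by (rule continuous_on_compose2[OF continuous_on_lerch_cont]) (use Suc.prems in \<open>auto intro!: continuous_intros\<close>)
    moreover have "continuous_on (?S \<times> {0..1}) (\<lambda>p. lerch_kernel lam (snd p))"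
      by (rule continuous_on_compose2[OF continuous_on_lerch_kernel[of UNIV]]) (auto intro!: continuous_intros)
    ultimately show "continuous_on (?S \<times> {0..1}) (\<lambda>(s, w). lerch_kernel lam w * lerch_cont lam k (s + 1) (u + w))"
      by (auto simp: case_prod_unfold intro!: continuous_intros)
    fix w :: real assume w: "w \<in> {0..1}"
    have "((\<lambda>s. lerch_cont lam k s (u + w)) \<circ> (\<lambda>s. s + 1)) holomorphic_on ?S"
      by (rule holomorphic_on_compose_gen[OF _ Suc.IH]) (use w Suc.prems in \<open>auto intro!: holomorphic_intros\<close>)
    then show "(\<lambda>s. lerch_kernel lam w * lerch_cont lam k (s + 1) (u + w)) holomorphic_on ?S"
      by (auto simp: o_def intro!: holomorphic_intros)
  qed
  then show ?case
    by (auto intro!: holomorphic_intros holomorphic_on_lerch_main)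
qed

text \<open>For \<open>Re s\<close> in \<open>(0, 1]\<close> the partial sums need not converge, but
  subtracting the boundary term repairs this: by \<open>lerch_partial_sum\<close> from 0 the
  difference is, up to a term free of \<open>M\<close>, an integral of partial sums at
  \<open>s + 1\<close>, and these converge uniformly. The bound \<open>R\<close> controls the factor
  \<open>s\<close>; uniformity over \<open>S\<close> later allows one \<open>M\<close> for a whole
  segment of the critical line.\<close>

lemma lerch_partial_sum_tendsto:
  assumes lam: "0 < lam" "lam \<le> 1" and u: "u > 0"
    and S: "S \<subseteq> {s. \<delta> \<le> Re s \<and> norm s \<le> R}" "1 \<notin> S" and \<delta>: "\<delta> > 0"
  shows "uniform_limit S (\<lambda>M s. (\<Sum>n<M. twist lam n * of_real (real n + u) powr (- s)) - lerch_boundary lam s M (real M + u))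
    (\<lambda>s. lerch_cont lam 1 s u / (s - 1)) sequentially"
proof (rule uniform_limitI)
  fix \<epsilon> :: real assume \<epsilon>: "\<epsilon> > 0"
  obtain K where K: "K \<ge> 0" "\<And>w. w \<in> {0..1} \<Longrightarrow> norm (lerch_kernel lam w) \<le> K"
    using lerch_kernel_bounded[of lam] by auto
  \<comment> \<open>The added ones keep the denominator positive and make the final estimate
    strict.\<close>
  define e where "e = \<epsilon> / ((\<bar>R\<bar> + 1) * (K + 1))"
  have e: "e > 0" using \<epsilon> K by (auto simp: e_def)
  from uniform_limitD[OF lerch_sum_uniform_limit[of "1 + \<delta>" lam] e] \<delta>
  have "\<forall>\<^sub>F M in sequentially. \<forall>p\<in>{(s, v). 1 + \<delta> \<le> Re s \<and> 0 < v}.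
        dist (case p of (s, v) \<Rightarrow> \<Sum>n<M. twist lam n * of_real (real n + v) powr (- s)) (case p of (s, v) \<Rightarrow> lerch_sum lam s v) < e"
    by auto
  then show "\<forall>\<^sub>F M in sequentially. \<forall>s\<in>S. dist ((\<Sum>n<M. twist lam n * of_real (real n + u) powr (- s)) - lerch_boundary lam s M (real M + u))
      (lerch_cont lam 1 s u / (s - 1)) < \<epsilon>"
  proof eventually_elim
    case (elim M)
    show ?case
    proof
      fix s assume s: "s \<in> S"
      then have s1: "s \<noteq> 1" and s\<delta>: "Re s \<ge> \<delta>" and sR: "norm s \<le> R" using S by auto
      define A where "A = (\<lambda>w. \<Sum>n<M. twist lam n * of_real (real n + (u + w)) powr (- (s + 1)))"
      define B where "B = (\<lambda>w. lerch_sum lam (s + 1) (u + w))"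
      have AB: "norm (A w - B w) \<le> e" if "w \<in> {0..1}" for w
        using elim[rule_format, of "(s + 1, u + w)"] that u s\<delta> by (simp add: A_def B_def dist_norm)
      have "continuous_on {0..1} (\<lambda>w. (\<lambda>(s, u). lerch_sum lam s u) (s + 1, u + w))"
        by (rule continuous_on_compose2[OF continuous_on_lerch_sum])
           (use u s\<delta> \<delta> in \<open>auto intro!: continuous_intros\<close>)
      then have contB: "continuous_on {0..1} B" by (simp add: B_def)
      have contA: "continuous_on {0..1} A"
        unfolding A_def using u
        by (intro continuous_on_sum continuous_on_mult continuous_on_const
           continuous_on_shift_powr continuous_intros) auto
      have hA: "((\<lambda>w. s * (lerch_kernel lam w * A w)) has_integral
          (\<Sum>n<M. twist lam n * of_real (real n + u) powr (- s)) -
          (lerch_boundary lam s M (real M + u) - lerch_boundary lam s 0 u)) {0..1}"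
        using lerch_partial_sum[OF lam u s1, of 0 M] by (simp add: A_def lessThan_atLeast0)
      have "lerch_cont lam 1 s u / (s - 1) =
          integral {0..1} (\<lambda>w. s * (lerch_kernel lam w * B w)) - lerch_boundary lam s 0 u"
      proof -
        \<comment> \<open>Level 0 at \<open>s + 1\<close> carries the normalisation
          \<open>(s + 1) - 1 = s\<close>, which is exactly the factor in front of the integral in
          \<open>lerch_partial_sum\<close>.\<close>
        have "integral {0..1} (\<lambda>w. lerch_kernel lam w * lerch_cont lam 0 (s + 1) (u + w)) =
            integral {0..1} (\<lambda>w. s * (lerch_kernel lam w * B w))"
          by (intro integral_cong) (simp add: B_def)
        moreover have "(1 - s) * b / (s - 1) = - b" for b
          using s1 by (simp add: field_simps)
        ultimately show ?thesis
          using s1 by (simp add: lerch_main_eq add_divide_distrib del: lerch_cont.simps(1))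
      qed
      moreover have "(\<Sum>n<M. twist lam n * of_real (real n + u) powr (- s)) - lerch_boundary lam s M (real M + u)
          = integral {0..1} (\<lambda>w. s * (lerch_kernel lam w * A w)) - lerch_boundary lam s 0 u"
        using integral_unique[OF hA] by simp
      ultimately have "dist ((\<Sum>n<M. twist lam n * of_real (real n + u) powr (- s)) - lerch_boundary lam s M (real M + u))
          (lerch_cont lam 1 s u / (s - 1)) =
          norm (integral {0..1} (\<lambda>w. s * (lerch_kernel lam w * A w)) - integral {0..1} (\<lambda>w. s * (lerch_kernel lam w * B w)))"
        by (simp add: dist_norm)
      also have "\<dots> = norm (integral {0..1} (\<lambda>w. s * (lerch_kernel lam w * (A w - B w))))"
      proof -
        have "(\<lambda>w. s * (lerch_kernel lam w * A w)) integrable_on {0..1}"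
             "(\<lambda>w. s * (lerch_kernel lam w * B w)) integrable_on {0..1}"
          by (intro integrable_continuous_interval continuous_on_mult continuous_on_const
                contA contB continuous_on_lerch_kernel)+
        from integral_diff[OF this] show ?thesis by (simp only: right_diff_distrib)
      qed
      also have "\<dots> \<le> (\<bar>R\<bar> * (K * e)) * (1 - 0)"
      proof (rule integral_bound)
        fix w :: real assume w: "w \<in> {0..1}"
        show "norm (s * (lerch_kernel lam w * (A w - B w))) \<le> \<bar>R\<bar> * (K * e)"
          unfolding norm_mult using sR K AB[OF w] w by (intro mult_mono) auto
      qed (simp, intro continuous_on_mult continuous_on_diff continuous_on_const contA contB continuous_on_lerch_kernel)
      also have "\<dots> < (\<bar>R\<bar> + 1) * ((K + 1) * e)"
      proof -
        have "r * (K * e) * (1 - 0) < (r + 1) * ((K + 1) * e)" if "r \<ge> 0" for r :: real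
        proof -
          have "0 \<le> r * e" "0 \<le> K * e" using that e K by auto
          then show ?thesis using e by (simp add: algebra_simps)
        qed
        then show ?thesis by simp
      qed
      also have "\<dots> = \<epsilon>" using K by (simp add: e_def)
      finally show "dist ((\<Sum>n<M. twist lam n * of_real (real n + u) powr (- s)) - lerch_boundary lam s M (real M + u))
          (lerch_cont lam 1 s u / (s - 1)) < \<epsilon>" .
    qed
  qed
qed

text \<open>The first summand covers \<open>lam = 1\<close> and the second all other
  \<open>lam\<close>, so that their sum serves both cases.\<close>

lemma lerch_boundary_bound:
  obtains C where "C \<ge> 0"
    "\<And>s n x. x > 0 \<Longrightarrow> norm (lerch_boundary lam s n x) \<le> x powr (1 - Re s) / norm (1 - s) + C * x powr (- Re s)"
proof
  show "norm (cis (- 2 * pi * lam) / (1 - cis (- 2 * pi * lam))) \<ge> 0" by simp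
  fix s n and x :: real assume x: "x > 0"
  show "norm (lerch_boundary lam s n x) \<le> x powr (1 - Re s) / norm (1 - s) +
      norm (cis (- 2 * pi * lam) / (1 - cis (- 2 * pi * lam))) * x powr (- Re s)"
    using x by (auto simp: lerch_boundary_def norm_mult norm_divide norm_of_real_powr)
qed

lemma lerch_boundary_tendsto_0:
  assumes "Re s > 1"
  shows "(\<lambda>M. lerch_boundary lam s M (real M + u)) \<longlonglongrightarrow> 0"
proof -
  obtain C where C: "C \<ge> 0"
    "\<And>s n x. x > 0 \<Longrightarrow> norm (lerch_boundary lam s n x) \<le> x powr (1 - Re s) / norm (1 - s) + C * x powr (- Re s)"
    using lerch_boundary_bound by blast
  have lim: "LIM M sequentially. real M + u :> at_top"
    using filterlim_tendsto_add_at_top[OF tendsto_const filterlim_real_sequentially, of u]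
    by (simp add: add.commute)
  show ?thesis
  proof (rule Lim_null_comparison)
    show "\<forall>\<^sub>F M in sequentially. norm (lerch_boundary lam s M (real M + u)) \<le>
       (real M + u) powr (1 - Re s) / norm (1 - s) + C * (real M + u) powr (- Re s)"
      using filterlim_at_top_dense[THEN iffD1, OF lim, rule_format, of 0]
      by eventually_elim (use C in blast)
    have "(\<lambda>M. (real M + u) powr (1 - Re s) / norm (1 - s) + C * (real M + u) powr (- Re s)) \<longlonglongrightarrow> 0 / norm (1 - s) + C * 0"
      using assms by (intro tendsto_intros tendsto_neg_powr lim) (auto simp: norm_eq_zero)
    then show "(\<lambda>M. (real M + u) powr (1 - Re s) / norm (1 - s) + C * (real M + u) powr (- Re s)) \<longlonglongrightarrow> 0"
      by simp
  qed
qed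

text \<open>In the base case \<open>Re s > 1\<close>, so the boundary term tends to 0 and the
  corrected partial sums have both levels as limits, after division by \<open>s - 1\<close>. In the
  step the levels differ only under the integral, where the argument is
  \<open>s + 1\<close>.\<close>

lemma lerch_cont_Suc_eq:
  assumes lam: "0 < lam" "lam \<le> 1"
  shows "Re s > 1 - real k \<Longrightarrow> u > 0 \<Longrightarrow> lerch_cont lam (Suc k) s u = lerch_cont lam k s u"
proof (induction k arbitrary: s u)
  case 0
  then have s: "Re s > 1" by simp
  then have s1: "s \<noteq> 1" by auto
  have "(\<lambda>M. (\<Sum>n<M. twist lam n * of_real (real n + u) powr (- s)) - lerch_boundary lam s M (real M + u))
      \<longlonglongrightarrow> lerch_cont lam 1 s u / (s - 1)"
    using tendsto_uniform_limitI[OF lerch_partial_sum_tendsto[OF lam \<open>u > 0\<close>, of "{s}" 1 "norm s"], of s] s s1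
    by auto
  moreover have "(\<lambda>M. (\<Sum>n<M. twist lam n * of_real (real n + u) powr (- s)) - lerch_boundary lam s M (real M + u))
      \<longlonglongrightarrow> lerch_sum lam s u - 0"
    using tendsto_uniform_limitI[OF lerch_sum_uniform_limit[OF s], of "(s, u)" lam] \<open>u > 0\<close>
    by (intro tendsto_diff lerch_boundary_tendsto_0 s) auto
  ultimately have "lerch_cont lam 1 s u / (s - 1) = lerch_sum lam s u"
    using LIMSEQ_unique by fastforce
  then show ?case using s1 by (simp add: field_simps)
next
  case (Suc k)
  have "integral {0..1} (\<lambda>w. lerch_kernel lam w * lerch_cont lam (Suc k) (s + 1) (u + w)) =
      integral {0..1} (\<lambda>w. lerch_kernel lam w * lerch_cont lam k (s + 1) (u + w))"
    using Suc.prems by (intro integral_cong) (subst Suc.IH, auto)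
  then show ?case by (simp only: lerch_cont.simps(2))
qed

lemma lerch_cont_eq:
  assumes "0 < lam" "lam \<le> 1" "Re s > 1 - real k" "u > 0" "k \<le> m"
  shows "lerch_cont lam m s u = lerch_cont lam k s u"
  using assms(5)
proof (induction m rule: dec_induct)
  case (step m)
  then show ?case using lerch_cont_Suc_eq[of lam m s u] assms by simp
qed simp

text \<open>Makes the choice in \<open>lerch_zeta\<close> usable by producing a witness. The levels
  agree where they overlap, so taking at each \<open>s\<close> a level \<open>k s\<close> that is
  high enough glues them to an entire function \<open>H\<close>; dividing by \<open>s - 1\<close>
  gives the continuation.\<close>

lemma lerch_zeta_spec:
  assumes "0 < \<alpha>" "0 < lam" "lam \<le> 1"
  shows "(\<lambda>s. lerch_zeta s \<alpha> lam) holomorphic_on (UNIV - {1})"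
    and "Re s > 1 \<Longrightarrow> lerch_zeta s \<alpha> lam = lerch_series \<alpha> lam s"
proof -
  define k where "k = (\<lambda>s. nat \<lceil>\<bar>Re s\<bar>\<rceil> + 2)"
  define H where "H = (\<lambda>s. lerch_cont lam (k s) s \<alpha>)"
  have k: "Re s > 1 - real (k s)" for s
  proof -
    have "\<bar>Re s\<bar> \<le> real (nat \<lceil>\<bar>Re s\<bar>\<rceil>)" by linarith
    then show ?thesis unfolding k_def by linarith
  qed
  have H: "H s = lerch_cont lam m s \<alpha>" if "Re s > 1 - real m" for s m
    using lerch_cont_eq[OF assms(2,3) that assms(1), of "max m (k s)"]
      lerch_cont_eq[OF assms(2,3) k assms(1), of s "max m (k s)"] by (simp add: H_def)
  have "H holomorphic_on (\<Union>m. {s. Re s > 1 - real m})"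
  proof (rule holomorphic_on_UN_open)
    show "H holomorphic_on {s. Re s > 1 - real m}" for m
      by (rule holomorphic_transform[OF holomorphic_on_lerch_cont[OF assms(1), of lam m]]) (simp add: H)
  qed (simp add: open_halfspace_Re_gt)
  moreover have "(\<Union>m. {s. Re s > 1 - real m}) = UNIV"
    using k by blast
  ultimately have "H holomorphic_on UNIV" by simp
  then have "(\<lambda>s. H s / (s - 1)) holomorphic_on (UNIV - {1})"
    by (auto intro!: holomorphic_intros intro: holomorphic_on_subset)
  moreover have "H z / (z - 1) = lerch_series \<alpha> lam z" if "Re z > 1" for z
  proof -
    have "z \<noteq> 1" using that by auto
    then show ?thesis using that assms by (simp add: H[of 0] lerch_series_eq)
  qed
  ultimately have "\<exists>f. f holomorphic_on (UNIV - {1}) \<and> (\<forall>z. Re z > 1 \<longrightarrow> f z = lerch_series \<alpha> lam z)"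
    by blast
  from someI_ex[OF this]
  show "(\<lambda>s. lerch_zeta s \<alpha> lam) holomorphic_on (UNIV - {1})"
    and "Re s > 1 \<Longrightarrow> lerch_zeta s \<alpha> lam = lerch_series \<alpha> lam s"
    by (simp_all add: lerch_zeta_def [abs_def])
qed

text \<open>The chosen function is known only through its defining property, so the identity theorem
  on the punctured right half-plane, which is connected, has to transfer the formula from
  \<open>Re s > 1\<close>.\<close>

lemma lerch_zeta_eq_lerch_cont:
  assumes "0 < \<alpha>" "0 < lam" "lam \<le> 1" and s: "Re s > 0" "s \<noteq> 1"
  shows "lerch_zeta s \<alpha> lam = lerch_cont lam 1 s \<alpha> / (s - 1)"
proof (rule analytic_continuation_open[where f = "\<lambda>s. lerch_zeta s \<alpha> lam"
      and g = "\<lambda>s. lerch_cont lam 1 s \<alpha> / (s - 1)" and s = "{s. Re s > 1}" and s' = "{s. Re s > 0} - {1}" and z = s])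
  show "open {s. 1 < Re s}" "open ({s. 0 < Re s} - {1})"
    by (auto simp: open_halfspace_Re_gt intro!: open_delete)
  show "{s. 1 < Re s} \<noteq> {}" using exI[of "\<lambda>s. 1 < Re s" 2] by auto
  show "connected ({s. 0 < Re s} - {1})"
    by (intro connected_open_delete) (auto simp: open_halfspace_Re_gt convex_connected convex_halfspace_Re_gt)
  show "{s. 1 < Re s} \<subseteq> {s. 0 < Re s} - {1}" by auto
  show "(\<lambda>s. lerch_zeta s \<alpha> lam) holomorphic_on {s. 0 < Re s} - {1}"
    by (rule holomorphic_on_subset[OF lerch_zeta_spec(1)[OF assms(1-3)]]) auto
  have "(\<lambda>s. lerch_cont lam 1 s \<alpha>) holomorphic_on {s. 0 < Re s} - {1}"
    by (rule holomorphic_on_subset[OF holomorphic_on_lerch_cont[OF assms(1)]]) auto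
  then show "(\<lambda>s. lerch_cont lam 1 s \<alpha> / (s - 1)) holomorphic_on {s. 0 < Re s} - {1}"
    by (intro holomorphic_intros) auto
  show "lerch_zeta z \<alpha> lam = lerch_cont lam 1 z \<alpha> / (z - 1)" if "z \<in> {s. 1 < Re s}" for z
  proof -
    have "z \<noteq> 1" using that by auto
    then show ?thesis
      using that assms lerch_cont_Suc_eq[OF assms(2,3), of 0 z \<alpha>]
      by (simp add: lerch_zeta_spec(2) lerch_series_eq)
  qed
  show "s \<in> {s. 0 < Re s} - {1}" using s by auto
qed

section \<open>Elementary sums\<close>

lemma sum_inverse_sqrt_le: "(\<Sum>n<N. (real n + 1) powr (- 1/2)) \<le> 2 * sqrt (real N)"
proof (induction N)
  case (Suc N)
  define a b where "a = sqrt (real N)" and "b = sqrt (real N + 1)"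
  have ab: "0 \<le> a" "a \<le> b" "0 < b" "b\<^sup>2 - a\<^sup>2 = 1" by (auto simp: a_def b_def)
  have "1 / b \<le> 2 * (b - a)"
  proof -
    have "1 = (b - a) * (b + a)" using ab by (simp add: power2_eq_square algebra_simps)
    also have "\<dots> \<le> (b - a) * (2 * b)" using ab by (intro mult_left_mono) auto
    finally show ?thesis using ab by (simp add: field_simps)
  qed
  moreover have "(real N + 1) powr (- 1/2) = 1 / b"
    using powr_minus_divide[of "real N + 1" "1/2"] by (simp add: b_def powr_half_sqrt)
  ultimately show ?case using Suc by (simp add: a_def b_def add.commute)
qed simp

text \<open>Telescoping against \<open>2 / n\<close>, since
  \<open>n + 1 \<le> 2 * n\<close>.\<close>

lemma sum_tail_square:
  assumes "1 \<le> N" "N \<le> M"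
  shows "(\<Sum>n\<in>{N..<M}. 1 / (real n)\<^sup>2) \<le> 2 / real N"
proof -
  have "(\<Sum>n\<in>{N..<M}. 1 / (real n)\<^sup>2) \<le> (\<Sum>n\<in>{N..<M}. (- 2 / real (Suc n)) - (- 2 / real n))"
  proof (rule sum_mono)
    fix n assume "n \<in> {N..<M}"
    then have n: "real n \<ge> 1" using assms by auto
    have "1 / (real n)\<^sup>2 = 2 / (real n * (2 * real n))" by (simp add: power2_eq_square)
    also have "\<dots> \<le> 2 / (real n * real (Suc n))"
      using n by (intro divide_left_mono mult_left_mono) auto
    also have "\<dots> = (- 2 / real (Suc n)) - (- 2 / real n)"
      using n by (simp add: field_simps)
    finally show "1 / (real n)\<^sup>2 \<le> (- 2 / real (Suc n)) - (- 2 / real n)" .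
  qed
  also have "\<dots> = - 2 / real M - (- 2 / real N)"
    by (rule sum_Suc_diff'[OF assms(2)])
  also have "\<dots> \<le> 2 / real N" by simp
  finally show ?thesis .
qed

lemma sum_tail_three_halves:
  assumes "1 \<le> N" "N \<le> M"
  shows "(\<Sum>n\<in>{N..<M}. real n powr (- 3/2)) \<le> 4 / sqrt (real N)"
proof -
  have "(\<Sum>n\<in>{N..<M}. real n powr (- 3/2)) \<le> (\<Sum>n\<in>{N..<M}. (- 4 / sqrt (real (Suc n))) - (- 4 / sqrt (real n)))"
  proof (rule sum_mono)
    fix n assume "n \<in> {N..<M}"
    then have n: "real n \<ge> 1" using assms by auto
    define a b where "a = sqrt (real n)" and "b = sqrt (real n + 1)"
    have ab: "1 \<le> a" "a \<le> b" "b\<^sup>2 = a\<^sup>2 + 1" using n by (auto simp: a_def b_def)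
    \<comment> \<open>A crude bound on the ratio of consecutive roots suffices for telescoping
      against \<open>4 / sqrt n\<close>: it gives
      \<open>(b + a) * (a * b) \<le> 15/4 * a ^ 3\<close>, just below
      \<open>4 * a ^ 3\<close>.\<close>
    have "b \<le> 3/2 * a"
    proof (rule power2_le_imp_le)
      have "1 \<le> a\<^sup>2" using ab by simp
      then show "b\<^sup>2 \<le> (3/2 * a)\<^sup>2" using ab by (simp add: power_mult_distrib power2_eq_square)
    qed (use ab in auto)
    have "(b - a) * (b + a) = 1" using ab by (simp add: power2_eq_square algebra_simps)
    then have ba: "b - a = 1 / (b + a)" using ab by (simp add: field_simps)
    have "real n powr (- 3/2) = 1 / a ^ 3"
    proof -
      have "real n powr (3/2) = (real n powr (1/2)) powr real 3"
        by (simp only: powr_powr) simp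
      also have "\<dots> = (real n powr (1/2)) ^ 3"
        using n by (subst powr_realpow) auto
      finally have "real n powr (3/2) = (real n powr (1/2)) ^ 3" .
      then have "real n powr (3/2) = a ^ 3" by (simp add: a_def powr_half_sqrt)
      then show ?thesis using powr_minus_divide[of "real n" "3/2"] by simp
    qed
    also have "1 / a ^ 3 \<le> 4 * (1 / (b + a)) / (a * b)"
    proof -
      have "b + a \<le> 5/2 * a" "a * b \<le> a * (3/2 * a)"
        using ab \<open>b \<le> 3/2 * a\<close> by (auto intro: mult_left_mono)
      then have "(b + a) * (a * b) \<le> (5/2 * a) * (a * (3/2 * a))"
        using ab by (intro mult_mono) auto
      also have "\<dots> = 15/4 * a ^ 3" by (simp add: power3_eq_cube)
      also have "\<dots> \<le> 4 * a ^ 3" using ab by (intro mult_right_mono) auto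
      finally have "4 / (4 * a ^ 3) \<le> 4 / ((b + a) * (a * b))"
        using ab by (intro divide_left_mono mult_pos_pos) auto
      then show ?thesis by simp
    qed
    also have "\<dots> = 4 * (b - a) / (a * b)" by (simp only: ba)
    also have "\<dots> = (- 4 / b) - (- 4 / a)"
      using ab by (simp add: diff_divide_distrib right_diff_distrib)
    finally show "real n powr (- 3/2) \<le> (- 4 / sqrt (real (Suc n))) - (- 4 / sqrt (real n))"
      by (simp add: a_def b_def add.commute)
  qed
  also have "\<dots> = - 4 / sqrt (real M) - (- 4 / sqrt (real N))"
    by (rule sum_Suc_diff'[OF assms(2)])
  also have "\<dots> \<le> 4 / sqrt (real N)" by simp
  finally show ?thesis .
qed

text \<open>Comparison with harmonic sums. From below each term dominates
  \<open>1 / (n + 1)\<close>; from above the first term \<open>1 / \<alpha>\<close> is split off and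
  the others are at most \<open>1 / n\<close>.\<close>

lemma sum_inverse_shift_ln:
  assumes "0 < \<alpha>" "\<alpha> \<le> 1" "N \<ge> 1"
  shows "\<bar>(\<Sum>n<N. 1 / (real n + \<alpha>)) - ln (real N)\<bar> \<le> 1 / \<alpha> + 1"
proof -
  have low: "ln (real N) \<le> (\<Sum>n<N. 1 / (real n + \<alpha>))"
  proof -
    have "ln (real N) \<le> ln (real N + 1)" using assms by simp
    also have "\<dots> \<le> harm N" by (rule ln_le_harm)
    also have "\<dots> = (\<Sum>n<N. 1 / (real n + 1))"
      by (simp add: harm_altdef inverse_eq_divide add.commute)
    also have "\<dots> \<le> (\<Sum>n<N. 1 / (real n + \<alpha>))"
      using assms by (intro sum_mono divide_left_mono) auto
    finally show ?thesis .
  qed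
  have up: "(\<Sum>n<Suc m. 1 / (real n + \<alpha>)) \<le> 1 / \<alpha> + harm m" for m
  proof (induction m)
    case (Suc m)
    have "1 / (real (Suc m) + \<alpha>) \<le> 1 / real (Suc m)"
      using assms by (intro divide_left_mono) auto
    with Suc show ?case by (simp add: harm_Suc inverse_eq_divide)
  qed (simp add: harm_nonneg)
  obtain m where m: "N = Suc m" using assms(3) by (cases N) auto
  have "harm (Suc 0) = (1 :: real)" by (simp add: harm_def)
  then have "harm N \<le> ln (real N) + 1"
    using decseqD[OF decseq_harm_diff_ln, of 0 m] m by simp
  moreover have "harm m \<le> (harm N :: real)" by (rule harm_mono) (simp add: m)
  ultimately have "(\<Sum>n<N. 1 / (real n + \<alpha>)) \<le> 1 / \<alpha> + 1 + ln (real N)"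
    using up[of m] m by simp
  with low show ?thesis by auto
qed

section \<open>Mean squares on the critical line\<close>

definition lerch_partial :: "real \<Rightarrow> nat \<Rightarrow> complex \<Rightarrow> real \<Rightarrow> complex" where
  "lerch_partial lam N s u = (\<Sum>n<N. twist lam n * of_real (real n + u) powr (- s))"

lemma of_real_powr_Complex:
  assumes "x > 0"
  shows "of_real x powr (- Complex a t) = of_real (x powr (- a)) * cis (- (t * ln x))"
proof -
  have "of_real x powr (- Complex a t) = exp (of_real (- a * ln x) + \<i> * of_real (- (t * ln x)))"
    using assms by (simp add: powr_def Ln_of_real Complex_eq algebra_simps)
  also have "\<dots> = of_real (x powr (- a)) * cis (- (t * ln x))"
    using assms by (simp only: exp_add cis_conv_exp exp_of_real) (simp add: powr_def)
  finally show ?thesis .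
qed

text \<open>The diagonal is a harmonic sum, equal to \<open>ln N + O(1)\<close>. The Hilbert weight
  cancels \<open>(cmod (b n))\<^sup>2\<close> exactly, and the squared sum of moduli is
  \<open>O(N / \<alpha>)\<close>; with \<open>N \<le> 2 * T\<close> both stay within
  \<open>O(T)\<close>.\<close>

lemma lerch_partial_mean_square:
  assumes \<alpha>: "0 < \<alpha>" "\<alpha> \<le> 1"
  obtains C where "C \<ge> 0"
    "\<And>T. T \<ge> 1 \<Longrightarrow> \<bar>integral {1..T} (\<lambda>t. (cmod (lerch_partial lam (nat \<lceil>T\<rceil>) (Complex (1/2) t) \<alpha>))\<^sup>2) - T * ln T\<bar> \<le> C * T"
proof
  \<comment> \<open>The first three summands come from the harmonic sum, from replacing
    \<open>ln N\<close> by \<open>ln T\<close>, and from the interval having length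
    \<open>T - 1\<close>; the last is the off-diagonal error with
    \<open>N \<le> 2 * T\<close>.\<close>
  define C where "C = (1 / \<alpha> + 1) + 1 + 1 + 2 * (pi * 2 + 8 / \<alpha>)"
  show "C \<ge> 0" using \<alpha> by (simp add: C_def)
  fix T :: real assume T: "T \<ge> 1"
  define N where "N = nat \<lceil>T\<rceil>"
  have N: "T \<le> real N" "real N \<le> 2 * T" "N \<ge> 1" using T unfolding N_def by linarith+
  define b where "b = (\<lambda>n. twist lam n * of_real ((real n + \<alpha>) powr (- (1/2))))"
  have cb: "cmod (b n) = (real n + \<alpha>) powr (- (1/2))" for n
    using \<alpha> by (simp add: b_def norm_mult)
  have cb2: "(cmod (b n))\<^sup>2 = 1 / (real n + \<alpha>)" for n
    using \<alpha> by (simp add: cb power2_eq_square powr_minus_divide flip: powr_add)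
  have P: "lerch_partial lam N (Complex (1/2) t) \<alpha> = (\<Sum>n<N. b n * cis (- (t * ln (real n + \<alpha>))))" for t
    unfolding lerch_partial_def b_def using \<alpha> by (intro sum.cong refl) (subst of_real_powr_Complex, auto)
  have "\<bar>integral {1..T} (\<lambda>t. (cmod (lerch_partial lam N (Complex (1/2) t) \<alpha>))\<^sup>2) - (T - 1) * (\<Sum>n<N. (cmod (b n))\<^sup>2)\<bar>
     \<le> 2 * (pi * (\<Sum>n<N. (cmod (b n))\<^sup>2 * (real n + \<alpha>)) + (\<Sum>n<N. cmod (b n))\<^sup>2)"
    unfolding P using \<alpha> T by (intro dirichlet_polynomial_mean_square) auto
  also have "(\<Sum>n<N. (cmod (b n))\<^sup>2 * (real n + \<alpha>)) = real N"
  proof -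
    have "(cmod (b n))\<^sup>2 * (real n + \<alpha>) = 1" for n
      using \<alpha> by (simp add: cb2 add_nonneg_eq_0_iff)
    then show ?thesis by simp
  qed
  also have "(\<Sum>n<N. cmod (b n))\<^sup>2 \<le> 4 * real N / \<alpha>"
  proof -
    have "(\<Sum>n<N. cmod (b n)) \<le> (\<Sum>n<N. \<alpha> powr (- (1/2)) * (real n + 1) powr (- 1/2))"
    proof (rule sum_mono)
      fix n
      \<comment> \<open>Trades the shift \<open>\<alpha>\<close> for a constant factor, so that the
        sum with shift 1 can be used.\<close>
      have "\<alpha> * (real n + 1) \<le> real n + \<alpha>"
        using \<alpha> mult_left_le_one_le[of "real n" \<alpha>] by (simp add: algebra_simps)
      then have "(real n + \<alpha>) powr (- (1/2)) \<le> (\<alpha> * (real n + 1)) powr (- (1/2))"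
        using \<alpha> by (intro powr_mono2') auto
      then show "cmod (b n) \<le> \<alpha> powr (- (1/2)) * (real n + 1) powr (- 1/2)"
        using \<alpha> by (simp add: cb powr_mult)
    qed
    also have "\<dots> = \<alpha> powr (- (1/2)) * (\<Sum>n<N. (real n + 1) powr (- 1/2))"
      by (simp only: sum_distrib_left)
    also have "\<dots> \<le> \<alpha> powr (- (1/2)) * (2 * sqrt (real N))"
      by (intro mult_left_mono sum_inverse_sqrt_le) simp
    finally have "(\<Sum>n<N. cmod (b n))\<^sup>2 \<le> (\<alpha> powr (- (1/2)) * (2 * sqrt (real N)))\<^sup>2"
      by (intro power_mono) (auto intro: sum_nonneg)
    also have "\<dots> = (\<alpha> powr (- (1/2)))\<^sup>2 * (4 * real N)"
      by (simp add: power_mult_distrib)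
    also have "(\<alpha> powr (- (1/2)))\<^sup>2 = 1 / \<alpha>"
      using \<alpha> by (simp add: power2_eq_square powr_minus_divide flip: powr_add)
    finally show ?thesis by simp
  qed
  also have "2 * (pi * real N + 4 * real N / \<alpha>) \<le> 2 * (pi * (2 * T) + 4 * (2 * T) / \<alpha>)"
    using N \<alpha> by (intro mult_left_mono add_mono divide_right_mono) auto
  also have "\<dots> = 2 * (pi * 2 + 8 / \<alpha>) * T" by (simp add: algebra_simps)
  finally have 1: "\<bar>integral {1..T} (\<lambda>t. (cmod (lerch_partial lam N (Complex (1/2) t) \<alpha>))\<^sup>2)
      - (T - 1) * (\<Sum>n<N. 1 / (real n + \<alpha>))\<bar> \<le> 2 * (pi * 2 + 8 / \<alpha>) * T"
    by (simp add: cb2)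
  define h where "h = (\<Sum>n<N. 1 / (real n + \<alpha>))"
  have h: "\<bar>h - ln (real N)\<bar> \<le> 1 / \<alpha> + 1"
    unfolding h_def by (rule sum_inverse_shift_ln[OF \<alpha> N(3)])
  have lnN: "\<bar>ln (real N) - ln T\<bar> \<le> 1"
  proof -
    have "ln T \<le> ln (real N)" using N T by simp
    moreover have "ln (real N) \<le> ln (2 * T)" using N T by simp
    moreover have "ln (2 * T) = ln 2 + ln T" using T by (simp add: ln_mult)
    ultimately show ?thesis using ln_2_less_1 by auto
  qed
  have "\<bar>(T - 1) * h - T * ln T\<bar> \<le> (1 / \<alpha> + 1) * T + T + T"
  proof -
    have "(T - 1) * h - T * ln T = (T - 1) * (h - ln (real N)) + (T - 1) * (ln (real N) - ln T) - ln T"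
      by (simp add: algebra_simps)
    moreover have "\<bar>(T - 1) * (h - ln (real N))\<bar> \<le> T * (1 / \<alpha> + 1)"
      unfolding abs_mult using T h by (intro mult_mono) auto
    moreover have "\<bar>(T - 1) * (ln (real N) - ln T)\<bar> \<le> T * 1"
      unfolding abs_mult using T lnN by (intro mult_mono) auto
    moreover have "\<bar>ln T\<bar> \<le> T" using T ln_le_minus_one[of T] by simp
    ultimately show ?thesis by (simp add: mult.commute)
  qed
  with 1 have "\<bar>integral {1..T} (\<lambda>t. (cmod (lerch_partial lam N (Complex (1/2) t) \<alpha>))\<^sup>2) - T * ln T\<bar>
      \<le> 2 * (pi * 2 + 8 / \<alpha>) * T + ((1 / \<alpha> + 1) * T + T + T)"
    unfolding h_def[symmetric] by linarith
  also have "\<dots> = C * T" by (simp add: C_def algebra_simps)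
  finally show "\<bar>integral {1..T} (\<lambda>t. (cmod (lerch_partial lam (nat \<lceil>T\<rceil>) (Complex (1/2) t) \<alpha>))\<^sup>2) - T * ln T\<bar> \<le> C * T"
    by (simp add: N_def)
qed

text \<open>The gain \<open>1 / T\<close> offsets the factor of size \<open>T\<^sup>2\<close> from
  \<open>s\<close> in the remainder. The constant is 2 from the diagonal, \<open>4 * pi\<close> from
  Hilbert's inequality and 32 from the squared sum of moduli. Since it is free of \<open>u\<close>
  and \<open>M\<close>, the bound can be integrated over \<open>w\<close> and used for any
  cut-off.\<close>

lemma tail_mean_square:
  assumes u: "u > 0" and T: "T \<ge> 1" and N: "T \<le> real N" "N \<le> M"
  shows "integral {1..T} (\<lambda>t. (cmod (\<Sum>n\<in>{N..<M}. twist lam n * of_real (real n + u) powr (- Complex (3/2) t)))\<^sup>2)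
           \<le> (34 + 4 * pi) / T"
proof -
  define b where "b = (\<lambda>n. twist lam n * of_real ((real n + u) powr (- (3/2))))"
  have N1: "N \<ge> 1" using N T by simp
  have cb: "cmod (b n) = (real n + u) powr (- (3/2))" for n
    using u by (simp add: b_def norm_mult)
  have cb2: "(cmod (b n))\<^sup>2 = 1 / (real n + u) ^ 3" for n
  proof -
    have "(cmod (b n))\<^sup>2 = (real n + u) powr (- 3)"
      by (simp add: cb power2_eq_square flip: powr_add)
    also have "\<dots> = 1 / (real n + u) powr (real 3)" by (simp add: powr_minus_divide)
    also have "\<dots> = 1 / (real n + u) ^ 3" using u by (subst powr_realpow) auto
    finally show ?thesis .
  qed
  have P: "(\<Sum>n\<in>{N..<M}. twist lam n * of_real (real n + u) powr (- Complex (3/2) t)) =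
      (\<Sum>n\<in>{N..<M}. b n * cis (- (t * ln (real n + u))))" for t
    unfolding b_def using u by (intro sum.cong refl) (subst of_real_powr_Complex, auto)
  have "\<bar>integral {1..T} (\<lambda>t. (cmod (\<Sum>n\<in>{N..<M}. twist lam n * of_real (real n + u) powr (- Complex (3/2) t)))\<^sup>2)
       - (T - 1) * (\<Sum>n\<in>{N..<M}. (cmod (b n))\<^sup>2)\<bar>
     \<le> 2 * (pi * (\<Sum>n\<in>{N..<M}. (cmod (b n))\<^sup>2 * (real n + u)) + (\<Sum>n\<in>{N..<M}. cmod (b n))\<^sup>2)"
    unfolding P using u T by (intro dirichlet_polynomial_mean_square) auto
  moreover have "(\<Sum>n\<in>{N..<M}. (cmod (b n))\<^sup>2 * (real n + u)) \<le> 2 / T"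
  proof -
    have "(\<Sum>n\<in>{N..<M}. (cmod (b n))\<^sup>2 * (real n + u)) \<le> (\<Sum>n\<in>{N..<M}. 1 / (real n)\<^sup>2)"
    proof (rule sum_mono)
      fix n assume "n \<in> {N..<M}"
      then have n: "real n \<ge> 1" using N1 by auto
      have "(cmod (b n))\<^sup>2 * (real n + u) = 1 / (real n + u)\<^sup>2"
        unfolding cb2 using n u by (simp add: power3_eq_cube power2_eq_square)
      also have "\<dots> \<le> 1 / (real n)\<^sup>2"
        using n u by (intro divide_left_mono power_mono mult_pos_pos) auto
      finally show "(cmod (b n))\<^sup>2 * (real n + u) \<le> 1 / (real n)\<^sup>2" .
    qed
    also have "\<dots> \<le> 2 / real N" by (rule sum_tail_square[OF N1 N(2)])
    also have "\<dots> \<le> 2 / T" using N T by (intro divide_left_mono) auto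
    finally show ?thesis .
  qed
  moreover have "(T - 1) * (\<Sum>n\<in>{N..<M}. (cmod (b n))\<^sup>2) \<le> 2 / T"
  proof -
    have "(\<Sum>n\<in>{N..<M}. (cmod (b n))\<^sup>2) \<le> (\<Sum>n\<in>{N..<M}. (1 / T) * (1 / (real n)\<^sup>2))"
    proof (rule sum_mono)
      fix n assume "n \<in> {N..<M}"
      then have n: "real n \<ge> T" "real n \<ge> 1" using N1 N by auto
      have "T * (real n)\<^sup>2 \<le> (real n + u) * (real n + u)\<^sup>2"
        using n u T by (intro mult_mono power_mono) auto
      then have "1 / ((real n + u) * (real n + u)\<^sup>2) \<le> 1 / (T * (real n)\<^sup>2)"
        using n u T by (intro divide_left_mono mult_pos_pos) auto
      then show "(cmod (b n))\<^sup>2 \<le> (1 / T) * (1 / (real n)\<^sup>2)"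
        unfolding cb2 by (simp add: power3_eq_cube power2_eq_square mult.assoc)
    qed
    also have "\<dots> = (1 / T) * (\<Sum>n\<in>{N..<M}. 1 / (real n)\<^sup>2)" by (simp only: sum_distrib_left)
    also have "\<dots> \<le> (1 / T) * (2 / real N)"
      using T by (intro mult_left_mono sum_tail_square N1 N) auto
    also have "\<dots> \<le> (1 / T) * (2 / T)"
      using N T by (intro mult_left_mono divide_left_mono) auto
    finally have "(T - 1) * (\<Sum>n\<in>{N..<M}. (cmod (b n))\<^sup>2) \<le> T * ((1 / T) * (2 / T))"
      using T by (intro mult_mono) (auto intro: sum_nonneg)
    also have "\<dots> = 2 / T" using T by simp
    finally show ?thesis .
  qed
  moreover have "(\<Sum>n\<in>{N..<M}. cmod (b n))\<^sup>2 \<le> 16 / T"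
  proof -
    have "(\<Sum>n\<in>{N..<M}. cmod (b n)) \<le> (\<Sum>n\<in>{N..<M}. real n powr (- 3/2))"
    proof (rule sum_mono)
      fix n assume "n \<in> {N..<M}"
      then have n: "real n \<ge> 1" using N1 by auto
      have "(real n + u) powr (- (3/2)) \<le> real n powr (- (3/2))"
        using n u by (intro powr_mono2') auto
      then show "cmod (b n) \<le> real n powr (- 3/2)" by (simp add: cb)
    qed
    also have "\<dots> \<le> 4 / sqrt (real N)" by (rule sum_tail_three_halves[OF N1 N(2)])
    finally have "(\<Sum>n\<in>{N..<M}. cmod (b n))\<^sup>2 \<le> (4 / sqrt (real N))\<^sup>2"
      by (intro power_mono) (auto intro: sum_nonneg)
    also have "\<dots> = 16 / real N" by (simp add: power_divide)
    also have "\<dots> \<le> 16 / T" using N T by (intro divide_left_mono) auto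
    finally show ?thesis .
  qed
  moreover have "pi * (\<Sum>n\<in>{N..<M}. (cmod (b n))\<^sup>2 * (real n + u)) \<le> pi * (2 / T)"
    by (intro mult_left_mono calculation(2)) simp
  moreover have "I \<le> c + 2 * (e + d)" if "\<bar>I - X\<bar> \<le> 2 * (Y + W)" "X \<le> c" "W \<le> d" "Y \<le> e"
    for I X Y W c d e :: real
  proof -
    have "I \<le> X + 2 * (Y + W)" using abs_le_D1[OF that(1)] by (simp only: diff_le_eq add.commute)
    also have "\<dots> \<le> c + 2 * (e + d)" by (intro add_mono mult_left_mono that) simp
    finally show ?thesis .
  qed
  ultimately have "integral {1..T} (\<lambda>t. (cmod (\<Sum>n\<in>{N..<M}. twist lam n * of_real (real n + u) powr (- Complex (3/2) t)))\<^sup>2)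
      \<le> 2 / T + 2 * (pi * (2 / T) + 16 / T)" by blast
  also have "\<dots> = (34 + 4 * pi) / T" by (simp add: add_divide_distrib)
  finally show ?thesis .
qed

text \<open>Nonnegativity of the variance: integrate the square of \<open>g - c\<close>, with
  \<open>c\<close> the mean of \<open>g\<close>.\<close>

lemma square_integral_le:
  fixes g :: "real \<Rightarrow> real"
  assumes "continuous_on {0..1} g"
  shows "(integral {0..1} g)\<^sup>2 \<le> integral {0..1} (\<lambda>w. (g w)\<^sup>2)"
proof -
  define c where "c = integral {0..1} g"
  have i: "(g has_integral c) {0..1}" "((\<lambda>w. (g w)\<^sup>2) has_integral integral {0..1} (\<lambda>w. (g w)\<^sup>2)) {0..1}"
    unfolding c_def using assms
    by (auto intro!: integrable_integral integrable_continuous_interval continuous_intros)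
  have "((\<lambda>w. (g w)\<^sup>2 - 2 * c * g w + c\<^sup>2) has_integral (integral {0..1} (\<lambda>w. (g w)\<^sup>2) - 2 * c * c + c\<^sup>2)) {0..1}"
    using has_integral_const_real[of "c\<^sup>2" 0 1]
    by (intro has_integral_add has_integral_diff i has_integral_mult_right) simp
  then have "0 \<le> integral {0..1} (\<lambda>w. (g w)\<^sup>2) - 2 * c * c + c\<^sup>2"
  proof (rule has_integral_nonneg)
    fix w
    have "(g w)\<^sup>2 - 2 * c * g w + c\<^sup>2 = (g w - c)\<^sup>2" by (simp add: power2_eq_square algebra_simps)
    then show "0 \<le> (g w)\<^sup>2 - 2 * c * g w + c\<^sup>2" by simp
  qed
  then show ?thesis by (simp add: c_def power2_eq_square)
qed

lemma continuous_on_lerch_zeta_line: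
  assumes "0 < \<alpha>" "0 < lam" "lam \<le> 1"
  shows "continuous_on A (\<lambda>t. lerch_zeta (Complex (1/2) t) \<alpha> lam)"
  by (rule continuous_on_compose2[OF holomorphic_on_imp_continuous_on[OF lerch_zeta_spec(1)[OF assms]]])
     (auto simp: complex_eq_iff intro!: continuous_intros)

lemma continuous_on_lerch_partial_line:
  assumes "0 < u"
  shows "continuous_on A (\<lambda>t. lerch_partial lam N (Complex (1/2) t) u)"
  unfolding lerch_partial_def using assms
  by (intro continuous_on_sum continuous_on_mult continuous_on_const
        continuous_on_shift_powr continuous_intros) auto

lemma square_sum3_le: "(a + b + c)\<^sup>2 \<le> 3 * (a\<^sup>2 + b\<^sup>2 + c\<^sup>2)" for a b c :: real
proof -
  have "3 * (a\<^sup>2 + b\<^sup>2 + c\<^sup>2) - (a + b + c)\<^sup>2 = (a - b)\<^sup>2 + (a - c)\<^sup>2 + (b - c)\<^sup>2"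
    by (simp add: power2_eq_square algebra_simps)
  moreover have "0 \<le> (a - b)\<^sup>2 + (a - c)\<^sup>2 + (b - c)\<^sup>2" by simp
  ultimately show ?thesis by linarith
qed

text \<open>A cut-off \<open>M\<close>, depending on \<open>T\<close>, replaces the infinite tail at
  a pointwise cost of at most 1. Between \<open>N\<close> and \<open>M\<close> the identity of
  \<open>lerch_partial_sum\<close> is exact, so the error has three parts: truncation, the remainder
  \<open>Q\<close>, and the boundary term at \<open>N\<close>.\<close>

lemma lerch_error_mean_square:
  assumes \<alpha>: "0 < \<alpha>" "\<alpha> \<le> 1" and lam: "0 < lam" "lam \<le> 1"
  obtains C where "C \<ge> 0"
    "\<And>T. T \<ge> 1 \<Longrightarrow> integral {1..T} (\<lambda>t. (cmod (lerch_zeta (Complex (1/2) t) \<alpha> lam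
        - lerch_partial lam (nat \<lceil>T\<rceil>) (Complex (1/2) t) \<alpha>))\<^sup>2) \<le> C * T"
proof -
  obtain K where K: "K \<ge> 0" "\<And>w. w \<in> {0..1} \<Longrightarrow> norm (lerch_kernel lam w) \<le> K"
    using lerch_kernel_bounded[of lam] by auto
  obtain B where B: "B \<ge> 0"
    "\<And>s n x. x > 0 \<Longrightarrow> norm (lerch_boundary lam s n x) \<le> x powr (1 - Re s) / norm (1 - s) + B * x powr (- Re s)"
    using lerch_boundary_bound by blast
  \<comment> \<open>The factor 3 is from squaring three summands; inside stand truncation,
    remainder, and the boundary term, where 6 reflects \<open>x \<le> 3 * T\<close>.\<close>
  define C where "C = 3 * (1 + 2 * K\<^sup>2 * (34 + 4 * pi) + 6 + 2 * B\<^sup>2)"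
  show ?thesis
  proof
    show "C \<ge> 0" by (simp add: C_def)
    fix T :: real assume T: "T \<ge> 1"
    define N where "N = nat \<lceil>T\<rceil>"
    have N: "T \<le> real N" "real N \<le> 2 * T" using T unfolding N_def by linarith+
    define s where "s = (\<lambda>t. Complex (1/2) t)"
    define S where "S = s ` {1..T}"
    define Z where "Z = (\<lambda>t. lerch_zeta (s t) \<alpha> lam)"
    define P where "P = (\<lambda>N t. lerch_partial lam N (s t) \<alpha>)"
    define J where "J = (\<lambda>N t. lerch_boundary lam (s t) N (real N + \<alpha>))"
    have s1: "s t \<noteq> 1" for t by (simp add: s_def complex_eq_iff)
    have snorm: "norm (s t) \<le> T + 1" if "t \<in> {1..T}" for t
      using cmod_le[of "s t"] that by (simp add: s_def)
    have "uniform_limit S (\<lambda>M s. (\<Sum>n<M. twist lam n * of_real (real n + \<alpha>) powr (- s)) - lerch_boundary lam s M (real M + \<alpha>))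
        (\<lambda>s. lerch_cont lam 1 s \<alpha> / (s - 1)) sequentially"
      by (rule lerch_partial_sum_tendsto[OF lam \<alpha>(1), where \<delta> = "1/2" and R = "T + 1"])
         (use snorm s1 in \<open>auto simp: S_def s_def\<close>)
    \<comment> \<open>Tolerance 1 is enough, because an error of 1 contributes only
      \<open>O(T)\<close> to the mean square.\<close>
    from eventually_conj[OF uniform_limitD[OF this zero_less_one] eventually_ge_at_top[of N]]
    obtain M where M: "N \<le> M" and M1: "\<And>z. z \<in> S \<Longrightarrow>
        dist ((\<Sum>n<M. twist lam n * of_real (real n + \<alpha>) powr (- z)) - lerch_boundary lam z M (real M + \<alpha>))
          (lerch_cont lam 1 z \<alpha> / (z - 1)) < 1"
      by (auto simp: eventually_sequentially)
    have e: "norm (Z t - (P M t - J M t)) \<le> 1" if "t \<in> {1..T}" for t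
    proof -
      have "Z t = lerch_cont lam 1 (s t) \<alpha> / (s t - 1)"
        unfolding Z_def using lerch_zeta_eq_lerch_cont[OF \<alpha>(1) lam, of "s t"] s1 by (simp add: s_def)
      moreover have "s t \<in> S" using that by (simp add: S_def)
      ultimately show ?thesis
        using M1[of "s t"] by (simp add: P_def J_def lerch_partial_def dist_norm norm_minus_commute)
    qed
    define \<tau> where "\<tau> = (\<lambda>t w. \<Sum>n\<in>{N..<M}. twist lam n * of_real (real n + (\<alpha> + w)) powr (- Complex (3/2) t))"
    define Q where "Q = (\<lambda>t. integral {0..1} (\<lambda>w. s t * (lerch_kernel lam w * \<tau> t w)))"
    define q where "q = (\<lambda>t. integral {0..1} (\<lambda>w. (cmod (\<tau> t w))\<^sup>2))"
    have cont\<tau>: "continuous_on ({1..T} \<times> {0..1}) (\<lambda>(t, w). \<tau> t w)"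
      unfolding \<tau>_def case_prod_unfold using \<alpha>
      by (intro continuous_on_sum continuous_on_mult continuous_on_const
            continuous_on_shift_powr continuous_intros) (auto simp: add_nonneg_pos add_pos_nonneg)
    have cont\<tau>t: "continuous_on {0..1} (\<tau> t)" for t
      unfolding \<tau>_def using \<alpha>
      by (intro continuous_on_sum continuous_on_mult continuous_on_const
            continuous_on_shift_powr continuous_intros) (auto simp: add_nonneg_pos add_pos_nonneg)
    have cont\<tau>2: "continuous_on ({1..T} \<times> {0..1}) (\<lambda>(t, w). (cmod (\<tau> t w))\<^sup>2)"
      using cont\<tau> by (auto simp: case_prod_unfold intro!: continuous_intros)
    have split: "Z t - P N t = (Z t - (P M t - J M t)) + Q t + (- J N t)" if "t \<in> {1..T}" for t
    proof -
      have ms: "- s t - 1 = - Complex (3/2) t" by (simp add: s_def complex_eq_iff)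
      have "Q t = (\<Sum>n\<in>{N..<M}. twist lam n * of_real (real n + \<alpha>) powr (- s t)) - (J M t - J N t)"
        using integral_unique[OF lerch_partial_sum[OF lam \<alpha>(1) s1 M, of t]]
        unfolding ms by (simp add: Q_def \<tau>_def J_def)
      moreover have "P M t = P N t + (\<Sum>n\<in>{N..<M}. twist lam n * of_real (real n + \<alpha>) powr (- s t))"
        unfolding P_def lerch_partial_def lessThan_atLeast0
        by (rule sum.atLeastLessThan_concat[symmetric]) (use M in auto)
      ultimately show ?thesis by simp
    qed
    have Qb: "(norm (Q t))\<^sup>2 \<le> 2 * T\<^sup>2 * K\<^sup>2 * q t" if t: "t \<in> {1..T}" for t
    proof -
      have "norm (Q t) \<le> integral {0..1} (\<lambda>w. (norm (s t) * K) * cmod (\<tau> t w))"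
        unfolding Q_def
      proof (rule integral_norm_bound_integral)
        show "(\<lambda>w. s t * (lerch_kernel lam w * \<tau> t w)) integrable_on {0..1}"
          by (intro integrable_continuous_interval continuous_on_mult continuous_on_const
                cont\<tau>t continuous_on_lerch_kernel)
        show "(\<lambda>w. (norm (s t) * K) * cmod (\<tau> t w)) integrable_on {0..1}"
          by (intro integrable_continuous_interval continuous_on_mult continuous_on_const
                continuous_on_norm cont\<tau>t)
        fix w :: real assume "w \<in> {0..1}"
        then have "norm (s t) * (norm (lerch_kernel lam w) * cmod (\<tau> t w)) \<le> norm (s t) * (K * cmod (\<tau> t w))"
          by (intro mult_left_mono mult_right_mono K) auto
        then show "norm (s t * (lerch_kernel lam w * \<tau> t w)) \<le> (norm (s t) * K) * cmod (\<tau> t w)"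
          by (simp add: norm_mult mult.assoc)
      qed
      then have "(norm (Q t))\<^sup>2 \<le> ((norm (s t) * K) * integral {0..1} (\<lambda>w. cmod (\<tau> t w)))\<^sup>2"
        by (intro power_mono) auto
      also have "\<dots> = (norm (s t))\<^sup>2 * K\<^sup>2 * (integral {0..1} (\<lambda>w. cmod (\<tau> t w)))\<^sup>2"
        by (simp add: power_mult_distrib)
      also have "\<dots> \<le> (norm (s t))\<^sup>2 * K\<^sup>2 * q t"
        unfolding q_def by (intro mult_left_mono square_integral_le continuous_on_norm cont\<tau>t) auto
      also have "\<dots> \<le> 2 * T\<^sup>2 * K\<^sup>2 * q t"
      proof -
        have "t\<^sup>2 \<le> T\<^sup>2" "1 \<le> T\<^sup>2" using t T by (auto intro: power_mono)
        moreover have "(norm (s t))\<^sup>2 = 1/4 + t\<^sup>2"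
          unfolding s_def cmod_power2 by (simp add: power_divide)
        ultimately have "(norm (s t))\<^sup>2 \<le> 2 * T\<^sup>2" by simp
        moreover have "0 \<le> q t" unfolding q_def
          by (intro integral_nonneg integrable_continuous_interval continuous_intros cont\<tau>t) auto
        ultimately show ?thesis by (intro mult_right_mono) auto
      qed
      finally show ?thesis .
    qed
    define x where "x = real N + \<alpha>"
    have x: "1 \<le> x" "x \<le> 3 * T" using N T \<alpha> by (auto simp: x_def)
    \<comment> \<open>The first part may be as large as order \<open>T\<close> near
      \<open>t = 1\<close>, but \<open>1 / t\<^sup>2\<close> has integral below 1, so its mean
      square is still \<open>O(T)\<close>.\<close>
    have Jb: "(norm (J N t))\<^sup>2 \<le> 2 * x * (1 / t\<^sup>2) + 2 * B\<^sup>2" if t: "t \<in> {1..T}" for t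
    proof -
      have "norm (J N t) \<le> x powr (1/2) / norm (1 - s t) + B * x powr (- (1/2))"
        using B(2)[of x "s t" N] x by (simp add: J_def x_def s_def)
      also have "\<dots> \<le> sqrt x / t + B * 1"
      proof (intro add_mono mult_left_mono B(1))
        have "t \<le> norm (1 - s t)" using abs_Im_le_cmod[of "1 - s t"] t by (simp add: s_def)
        then show "x powr (1/2) / norm (1 - s t) \<le> sqrt x / t"
          using x t by (simp add: powr_half_sqrt frac_le)
        have "x powr (- (1/2)) \<le> 1 powr (- (1/2))" using x by (intro powr_mono2') auto
        then show "x powr (- (1/2)) \<le> 1" by simp
      qed
      finally have "(norm (J N t))\<^sup>2 \<le> (sqrt x / t + B)\<^sup>2" by (intro power_mono) auto
      also have "\<dots> \<le> 2 * (sqrt x / t)\<^sup>2 + 2 * B\<^sup>2"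
        using sum_squares_bound[of "sqrt x / t" B] by (simp add: power2_sum)
      also have "\<dots> = 2 * x * (1 / t\<^sup>2) + 2 * B\<^sup>2" using x by (simp add: power_divide)
      finally show ?thesis .
    qed
    have int_q: "(q has_integral integral {1..T} q) {1..T}" and q_le: "integral {1..T} q \<le> (34 + 4 * pi) / T"
    proof -
      have "continuous_on {1..T} q"
        unfolding q_def using integral_continuous_on_param[of "{1..T}" 0 1 "\<lambda>t w. (cmod (\<tau> t w))\<^sup>2"] cont\<tau>2 by simp
      then show "(q has_integral integral {1..T} q) {1..T}"
        by (intro integrable_integral integrable_continuous_interval)
      have "continuous_on ({0..1} \<times> {1..T}) (\<lambda>p. (\<lambda>(t, w). (cmod (\<tau> t w))\<^sup>2) (snd p, fst p))"
        by (rule continuous_on_compose2[OF cont\<tau>2]) (auto intro!: continuous_intros)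
      then have c: "continuous_on {0..1} (\<lambda>w. integral {1..T} (\<lambda>t. (cmod (\<tau> t w))\<^sup>2))"
        using integral_continuous_on_param[of "{0..1}" 1 T "\<lambda>w t. (cmod (\<tau> t w))\<^sup>2"] by (simp add: case_prod_unfold)
      \<comment> \<open>After exchanging the integrals, the tail bound applies for each fixed
        \<open>w\<close> with \<open>u = \<alpha> + w\<close>.\<close>
      have "integral {1..T} q = integral {0..1} (\<lambda>w. integral {1..T} (\<lambda>t. (cmod (\<tau> t w))\<^sup>2))"
        unfolding q_def using integral_swap_continuous[of 1 0 T 1 "\<lambda>t w. (cmod (\<tau> t w))\<^sup>2"] cont\<tau>2
        by (simp add: cbox_Pair_eq)
      also have "\<dots> \<le> integral {0..1} (\<lambda>w::real. (34 + 4 * pi) / T)"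
        unfolding \<tau>_def
        by (intro integral_le tail_mean_square T N M integrable_continuous_interval c[unfolded \<tau>_def])
           (use \<alpha> in auto)
      finally show "integral {1..T} q \<le> (34 + 4 * pi) / T" by simp
    qed
    have int_inv: "((\<lambda>t. 1 / t\<^sup>2) has_integral (1 - 1 / T)) {1..T}"
    proof -
      have "((\<lambda>t. 1 / t\<^sup>2) has_integral (- 1 / T - (- 1 / 1))) {1..T}"
      proof (rule fundamental_theorem_of_calculus[OF T])
        fix t :: real assume "t \<in> {1..T}"
        then have "((\<lambda>t. - 1 / t) has_real_derivative 1 / t\<^sup>2) (at t within {1..T})"
          by (auto intro!: derivative_eq_intros simp: power2_eq_square)
        then show "((\<lambda>t. - 1 / t) has_vector_derivative 1 / t\<^sup>2) (at t within {1..T})"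
          by (simp add: has_real_derivative_iff_has_vector_derivative)
      qed
      then show ?thesis by simp
    qed
    have const: "((\<lambda>t. c) has_integral c * (T - 1)) {1..T}" for c :: real
      using has_integral_const_real[of c 1 T] T by (simp add: mult.commute)
    have "integral {1..T} (\<lambda>t. (cmod (Z t - P N t))\<^sup>2) \<le>
       3 * (1 * (T - 1) + 2 * T\<^sup>2 * K\<^sup>2 * integral {1..T} q + (2 * x * (1 - 1 / T) + 2 * B\<^sup>2 * (T - 1)))"
    proof (rule has_integral_le)
      show "((\<lambda>t. (cmod (Z t - P N t))\<^sup>2) has_integral integral {1..T} (\<lambda>t. (cmod (Z t - P N t))\<^sup>2)) {1..T}"
        unfolding Z_def P_def s_def
        by (intro integrable_integral integrable_continuous_interval continuous_intros
              continuous_on_lerch_zeta_line continuous_on_lerch_partial_line \<alpha> lam)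
      show "((\<lambda>t. 3 * (1 + 2 * T\<^sup>2 * K\<^sup>2 * q t + (2 * x * (1 / t\<^sup>2) + 2 * B\<^sup>2))) has_integral
        3 * (1 * (T - 1) + 2 * T\<^sup>2 * K\<^sup>2 * integral {1..T} q + (2 * x * (1 - 1 / T) + 2 * B\<^sup>2 * (T - 1)))) {1..T}"
        by (intro has_integral_mult_right has_integral_add const int_q int_inv)
      fix t assume t: "t \<in> {1..T}"
      have "cmod (Z t - P N t) \<le> norm (Z t - (P M t - J M t)) + norm (Q t) + norm (J N t)"
        unfolding split[OF t] by (intro order.trans[OF norm_triangle_ineq] add_mono) auto
      then have "(cmod (Z t - P N t))\<^sup>2 \<le> (norm (Z t - (P M t - J M t)) + norm (Q t) + norm (J N t))\<^sup>2"
        by (intro power_mono) auto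
      also have "\<dots> \<le> 3 * ((norm (Z t - (P M t - J M t)))\<^sup>2 + (norm (Q t))\<^sup>2 + (norm (J N t))\<^sup>2)"
        by (rule square_sum3_le)
      also have "\<dots> \<le> 3 * (1 + 2 * T\<^sup>2 * K\<^sup>2 * q t + (2 * x * (1 / t\<^sup>2) + 2 * B\<^sup>2))"
        by (intro mult_left_mono add_mono Qb Jb t power_le_one e) auto
      finally show "(cmod (Z t - P N t))\<^sup>2 \<le> 3 * (1 + 2 * T\<^sup>2 * K\<^sup>2 * q t + (2 * x * (1 / t\<^sup>2) + 2 * B\<^sup>2))" .
    qed
    also have "\<dots> \<le> 3 * (T + 2 * K\<^sup>2 * (34 + 4 * pi) * T + (6 * T + 2 * B\<^sup>2 * T))"
    proof (intro mult_left_mono add_mono)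
      have "2 * T\<^sup>2 * K\<^sup>2 * integral {1..T} q \<le> 2 * T\<^sup>2 * K\<^sup>2 * ((34 + 4 * pi) / T)"
        by (intro mult_left_mono q_le) auto
      also have "\<dots> = 2 * K\<^sup>2 * (34 + 4 * pi) * T" using T by (simp add: power2_eq_square)
      finally show "2 * T\<^sup>2 * K\<^sup>2 * integral {1..T} q \<le> 2 * K\<^sup>2 * (34 + 4 * pi) * T" .
      have "2 * x * (1 - 1 / T) \<le> 2 * x * 1" using x T by (intro mult_left_mono) auto
      also have "\<dots> \<le> 6 * T" using x by simp
      finally show "2 * x * (1 - 1 / T) \<le> 6 * T" .
    qed (use T in auto)
    also have "\<dots> = C * T" by (simp add: C_def algebra_simps)
    finally show "integral {1..T} (\<lambda>t. (cmod (lerch_zeta (Complex (1/2) t) \<alpha> lam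
        - lerch_partial lam (nat \<lceil>T\<rceil>) (Complex (1/2) t) \<alpha>))\<^sup>2) \<le> C * T"
      by (simp add: Z_def P_def s_def N_def)
  qed
qed

text \<open>Used with \<open>L = sqrt (ln T)\<close>, which balances the two mean squares.\<close>
lemma norm_square_diff_le:
  fixes z p :: complex
  assumes "L > 0"
  shows "\<bar>(cmod z)\<^sup>2 - (cmod p)\<^sup>2\<bar> \<le> (1 + L) * (cmod (z - p))\<^sup>2 + (1 / L) * (cmod p)\<^sup>2"
proof -
  define a b where "a = cmod p" and "b = cmod (z - p)"
  have tri: "\<bar>cmod z - a\<bar> \<le> b" unfolding a_def b_def by (rule norm_triangle_ineq3)
  have "\<bar>(cmod z)\<^sup>2 - a\<^sup>2\<bar> = \<bar>cmod z - a\<bar> * (cmod z + a)"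
    by (simp add: power2_eq_square square_diff_square_factored abs_mult a_def)
  also have "\<dots> \<le> b * (b + 2 * a)"
    using tri by (intro mult_mono) (auto simp: a_def b_def abs_le_iff)
  also have "\<dots> = b\<^sup>2 + 2 * a * b" by (simp add: power2_eq_square algebra_simps)
  also have "2 * a * b \<le> L * b\<^sup>2 + (1 / L) * a\<^sup>2"
  proof -
    have "0 \<le> (L * b - a)\<^sup>2 / L" using assms by simp
    also have "\<dots> = L * b\<^sup>2 + (1 / L) * a\<^sup>2 - 2 * a * b"
      using assms by (simp add: power2_eq_square field_simps)
    finally show ?thesis by simp
  qed
  finally show ?thesis by (simp add: a_def b_def algebra_simps)
qed

text \<open>With \<open>L = sqrt (ln T)\<close> the error part is at most of order
  \<open>L * T\<close> and the part from the polynomial of order \<open>T * ln T / L\<close>, which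
  is the same. For \<open>T \<ge> exp 1\<close> one has \<open>L \<ge> 1\<close>, so every
  \<open>O(T)\<close> is absorbed, including \<open>T * ln (2 * pi)\<close>, the difference between
  \<open>T * ln T\<close> and the stated main term.\<close>

lemma lerch_mean_square:
  assumes \<alpha>: "0 < \<alpha>" "\<alpha> \<le> 1" and lam: "0 < lam" "lam \<le> 1"
  shows "(\<lambda>T. integral {1..T} (\<lambda>t. (cmod (lerch_zeta (Complex (1/2) t) \<alpha> lam))\<^sup>2) - T * ln (T / (2 * pi)))
           \<in> O[at_top](\<lambda>T. T * (ln T) powr (1/2))"
proof -
  obtain C1 where C1: "C1 \<ge> 0" "\<And>T. T \<ge> 1 \<Longrightarrow>
      \<bar>integral {1..T} (\<lambda>t. (cmod (lerch_partial lam (nat \<lceil>T\<rceil>) (Complex (1/2) t) \<alpha>))\<^sup>2) - T * ln T\<bar> \<le> C1 * T"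
    using lerch_partial_mean_square[OF \<alpha>, of lam] by blast
  obtain C2 where C2: "C2 \<ge> 0" "\<And>T. T \<ge> 1 \<Longrightarrow> integral {1..T} (\<lambda>t. (cmod (lerch_zeta (Complex (1/2) t) \<alpha> lam
        - lerch_partial lam (nat \<lceil>T\<rceil>) (Complex (1/2) t) \<alpha>))\<^sup>2) \<le> C2 * T"
    using lerch_error_mean_square[OF \<alpha> lam] by blast
  \<comment> \<open>\<open>2 * C2\<close> bounds the weighted error part, \<open>1 + C1\<close> the
    polynomial divided by \<open>L\<close>, the second \<open>C1\<close> the deviation of the
    polynomial's mean square from \<open>T * ln T\<close>, and the last summand the shift by
    \<open>2 * pi\<close>.\<close>
  define C where "C = 2 * C2 + 1 + C1 + C1 + ln (2 * pi)"
  have ln2pi: "ln (2 * pi) \<ge> 0" using pi_gt3 by simp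
  have "\<bar>integral {1..T} (\<lambda>t. (cmod (lerch_zeta (Complex (1/2) t) \<alpha> lam))\<^sup>2) - T * ln (T / (2 * pi))\<bar>
      \<le> C * \<bar>T * (ln T) powr (1/2)\<bar>" if "T \<ge> exp 1" for T
  proof -
    have T: "T \<ge> 1" using that one_le_exp_iff[of "1::real"] by linarith
    have lnT: "ln T \<ge> 1" using that T ln_ge_iff[of T 1] by simp
    define L where "L = sqrt (ln T)"
    have L: "L \<ge> 1" "L * L = ln T" using lnT by (auto simp: L_def)
    define Z where "Z = (\<lambda>t. lerch_zeta (Complex (1/2) t) \<alpha> lam)"
    define P where "P = (\<lambda>t. lerch_partial lam (nat \<lceil>T\<rceil>) (Complex (1/2) t) \<alpha>)"
    have cont: "continuous_on {1..T} Z" "continuous_on {1..T} P"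
      unfolding Z_def P_def
      by (intro continuous_on_lerch_zeta_line continuous_on_lerch_partial_line \<alpha> lam)+
    define IZ where "IZ = integral {1..T} (\<lambda>t. (cmod (Z t))\<^sup>2)"
    define IP where "IP = integral {1..T} (\<lambda>t. (cmod (P t))\<^sup>2)"
    define IE where "IE = integral {1..T} (\<lambda>t. (cmod (Z t - P t))\<^sup>2)"
    have iZ: "((\<lambda>t. (cmod (Z t))\<^sup>2) has_integral IZ) {1..T}"
      and iP: "((\<lambda>t. (cmod (P t))\<^sup>2) has_integral IP) {1..T}"
      and iE: "((\<lambda>t. (cmod (Z t - P t))\<^sup>2) has_integral IE) {1..T}"
      unfolding IZ_def IP_def IE_def
      by (intro integrable_integral integrable_continuous_interval continuous_intros cont)+
    have IP: "\<bar>IP - T * ln T\<bar> \<le> C1 * T" using C1(2)[OF T] by (simp add: IP_def P_def)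
    have IE: "IE \<le> C2 * T" using C2(2)[OF T] by (simp add: IE_def Z_def P_def)
    have "\<bar>IZ - IP\<bar> \<le> (1 + L) * IE + (1 / L) * IP"
    proof -
      have "norm (integral {1..T} (\<lambda>t. (cmod (Z t))\<^sup>2 - (cmod (P t))\<^sup>2))
          \<le> integral {1..T} (\<lambda>t. (1 + L) * (cmod (Z t - P t))\<^sup>2 + (1 / L) * (cmod (P t))\<^sup>2)"
      proof (rule integral_norm_bound_integral)
        show "(\<lambda>t. (cmod (Z t))\<^sup>2 - (cmod (P t))\<^sup>2) integrable_on {1..T}"
          using has_integral_diff[OF iZ iP] by blast
        show "(\<lambda>t. (1 + L) * (cmod (Z t - P t))\<^sup>2 + (1 / L) * (cmod (P t))\<^sup>2) integrable_on {1..T}"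
          using has_integral_add[OF has_integral_mult_right[OF iE] has_integral_mult_right[OF iP]] by blast
        show "norm ((cmod (Z t))\<^sup>2 - (cmod (P t))\<^sup>2) \<le> (1 + L) * (cmod (Z t - P t))\<^sup>2 + (1 / L) * (cmod (P t))\<^sup>2" for t
          unfolding real_norm_def by (rule norm_square_diff_le) (use L in simp)
      qed
      then show ?thesis
        using integral_unique[OF has_integral_diff[OF iZ iP]]
          integral_unique[OF has_integral_add[OF has_integral_mult_right[OF iE, of "1 + L"] has_integral_mult_right[OF iP, of "1 / L"]]]
        by simp
    qed
    moreover have "(1 + L) * IE \<le> 2 * C2 * (T * L)"
    proof -
      have "(1 + L) * IE \<le> (1 + L) * (C2 * T)" using IE L by (intro mult_left_mono) auto
      also have "\<dots> \<le> (2 * L) * (C2 * T)" using L C2 T by (intro mult_right_mono) auto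
      finally show ?thesis by (simp add: mult_ac)
    qed
    moreover have "(1 / L) * IP \<le> (1 + C1) * (T * L)"
    proof -
      have "(1 / L) * IP \<le> (1 / L) * (T * ln T + C1 * T)" using IP L by (intro mult_left_mono) auto
      also have "\<dots> = T * L + (1 / L) * (C1 * T)"
        using L by (simp add: distrib_left flip: L(2))
      also have "(1 / L) * (C1 * T) \<le> L * (C1 * T)"
      proof (intro mult_right_mono)
        have "1 / L \<le> 1" using L by simp
        then show "1 / L \<le> L" using L by linarith
      qed (use C1 T in auto)
      finally show ?thesis by (simp add: algebra_simps)
    qed
    moreover have "C1 * T \<le> C1 * (T * L)" "ln (2 * pi) * T \<le> ln (2 * pi) * (T * L)"
      using C1 T L ln2pi by (auto intro!: mult_left_mono)
    moreover have "T * ln (T / (2 * pi)) = T * ln T - ln (2 * pi) * T"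
      using T by (simp add: ln_div algebra_simps)
    moreover have "0 \<le> ln (2 * pi) * T" using ln2pi T by simp
    ultimately have "\<bar>IZ - T * ln (T / (2 * pi))\<bar> \<le>
        2 * C2 * (T * L) + (1 + C1) * (T * L) + C1 * (T * L) + ln (2 * pi) * (T * L)"
      using IP by linarith
    also have "\<dots> = C * (T * L)" by (simp add: C_def algebra_simps)
    also have "T * L = \<bar>T * (ln T) powr (1/2)\<bar>"
      using T L lnT by (simp add: L_def powr_half_sqrt abs_mult)
    finally show ?thesis by (simp add: IZ_def Z_def)
  qed
  then have "\<forall>\<^sub>F T in at_top. norm (integral {1..T} (\<lambda>t. (cmod (lerch_zeta (Complex (1/2) t) \<alpha> lam))\<^sup>2) - T * ln (T / (2 * pi)))
      \<le> C * norm (T * (ln T) powr (1/2))"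
    unfolding real_norm_def by (rule eventually_mono[OF eventually_ge_at_top[of "exp 1"]])
  then show ?thesis by (rule bigoI)
qed

theorem theorem3:
  fixes \<alpha> lam :: real
  assumes "0 < \<alpha>" "\<alpha> \<le> 1" "0 < lam" "lam \<le> 1"
  shows "(\<alpha> < 1 \<longrightarrow>
           (\<lambda>T. integral {1..T} (\<lambda>t. (cmod (lerch_zeta (Complex (1/2) t) \<alpha> lam))\<^sup>2)
                 - T * ln (T / (2 * pi)))
           \<in> O[at_top](\<lambda>T. T * (ln T) powr (1/2)))
       \<and> (\<alpha> = 1 \<longrightarrow>
           (\<lambda>T. integral {1..T} (\<lambda>t. (cmod (lerch_zeta (Complex (1/2) t) \<alpha> lam))\<^sup>2)
                 - T * ln (T / (2 * pi)))
           \<in> O[at_top](\<lambda>T. T * (ln T) powr (3/4)))"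
proof (intro conjI impI)
  note main = lerch_mean_square[OF assms]
  show "(\<lambda>T. integral {1..T} (\<lambda>t. (cmod (lerch_zeta (Complex (1/2) t) \<alpha> lam))\<^sup>2) - T * ln (T / (2 * pi)))
      \<in> O[at_top](\<lambda>T. T * (ln T) powr (1/2))" by (rule main)
  \<comment> \<open>For \<open>\<alpha> = 1\<close> the bound already proved is only relaxed, using
    \<open>ln T \<ge> 1\<close> for large \<open>T\<close>.\<close>
  have "(\<lambda>T. T * (ln T) powr (1/2)) \<in> O[at_top](\<lambda>T::real. T * (ln T) powr (3/4))"
  proof (rule bigoI[of _ 1])
    show "\<forall>\<^sub>F T::real in at_top. norm (T * (ln T) powr (1/2)) \<le> 1 * norm (T * (ln T) powr (3/4))"
      using eventually_ge_at_top[of "exp 1"]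
    proof eventually_elim
      case (elim T)
      have "T > 0" using elim exp_gt_zero[of "1::real"] by linarith
      then have "ln T \<ge> 1" using elim ln_ge_iff[of T 1] by simp
      then have "(ln T) powr (1/2) \<le> (ln T) powr (3/4)" by (intro powr_mono) auto
      then show ?case using \<open>T > 0\<close> by (simp add: abs_mult)
    qed
  qed
  then show "(\<lambda>T. integral {1..T} (\<lambda>t. (cmod (lerch_zeta (Complex (1/2) t) \<alpha> lam))\<^sup>2) - T * ln (T / (2 * pi)))
      \<in> O[at_top](\<lambda>T. T * (ln T) powr (3/4))"
    by (rule landau_o.big_trans[OF main])
qed

end
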